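(* Let $1<p<2$ and let $2<q<\infty$ satisfy $\frac1p+\frac1q=1$. There exist numbers $\alpha,\delta>0$, depending on $p$, such that the following holds. Let $F=(F_n)_{n\in\mathbb{Z}}$ be any sequence of complex numbers with $|F_n|<1$ for every $n$, with only finitely many $F_n$ nonzero, that is not identically $0$ and satisfies \[ \|F\|_{\ell^1(\mathbb{Z})}\leq \delta \bigg(1-\frac{\|F\|_{\ell^\infty(\mathbb{Z})}}{\|F\|_{\ell^p(\mathbb{Z})}}\bigg)^{\alpha}. \] Let $A_n=(1-|F_n|^2)^{-1/2}$ and let $a\colon\mathbb{T}\to\mathbb{C}$ be the upper-left entry of the $\mathrm{SU}(1,1)$-valued trigonometric product with coefficients $F$. Then \[ \big\|(\log|a(t)|^2)^{1/2}\big\|_{\mathrm{L}^q_t(\mathbb{T})} \leq \big\|(\log|A_n|^2)^{1/2}\big\|_{\ell^p_n(\mathbb{Z})}. \]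
   Context: $\mathbb{T}=\mathbb{R}/\mathbb{Z}\equiv[0,1)$ carries Lebesgue measure of total mass $1$. For a sequence $F=(F_n)_{n\in\mathbb{Z}}$ of complex numbers in the open unit disk with only finitely many nonzero terms, set \[ A_n := \frac{1}{(1-|F_n|^2)^{1/2}},\qquad B_n := \frac{F_n}{(1-|F_n|^2)^{1/2}}, \] so that $A_n>0$ and $A_n^2-|B_n|^2=1$. The $\mathrm{SU}(1,1)$-valued trigonometric (Fourier) product with coefficients $F$ is defined for $t\in\mathbb{T}$ by \[ \begin{bmatrix} a(t) & b(t) \\ \overline{b(t)} & \overline{a(t)} \end{bmatrix} := \prod_{n=-\infty}^{\infty} \begin{bmatrix} A_n & B_n e^{2\pi i n t} \\ \overline{B_n} e^{-2\pi i n t} & A_n \end{bmatrix}, \] where the matrices are multiplied from left to right as $n$ increases. Only finitely many factors differ from the identity matrix, so the product is effectively finite. For each $t$ the product lies in \[ \mathrm{SU}(1,1)=\Big\{\begin{bmatrix}\alpha&\beta\\ \overline\beta&\overline\alpha\end{bmatrix}:\alpha,\beta\in\mathbb{C},\ |\alpha|^2-|\beta|^2=1\Big\}, \] so $|a(t)|\ge1$ and $\log|a(t)|^2\geq 0$. The subscripts $t$ and $n$ in $\mathrm{L}^q_t(\mathbb{T})$ and $\ell^p_n(\mathbb{Z})$ indicate the variable in which the norm is taken. *)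

theory Defs
  imports "HOL-Analysis.Analysis"
begin

definition coeff_A :: "(int \<Rightarrow> complex) \<Rightarrow> int \<Rightarrow> real" where
  "coeff_A F n = 1 / sqrt (1 - (cmod (F n))\<^sup>2)"

definition coeff_B :: "(int \<Rightarrow> complex) \<Rightarrow> int \<Rightarrow> complex" where
  "coeff_B F n = F n / of_real (sqrt (1 - (cmod (F n))\<^sup>2))"

definition su11_factor :: "(int \<Rightarrow> complex) \<Rightarrow> real \<Rightarrow> int \<Rightarrow> complex^2^2" where
  "su11_factor F t n = vector
     [vector [of_real (coeff_A F n), coeff_B F n * cis (2 * pi * of_int n * t)],
      vector [cnj (coeff_B F n) * cis (- (2 * pi * of_int n * t)), of_real (coeff_A F n)]]"

text \<open>The bi-infinite product of the \<open>M n\<close>, multiplied from left to right as \<open>n\<close> increases,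
  for families in which only finitely many factors differ from the identity matrix.
  (\<open>**\<close> is the matrix product; \<open>*\<close> on this type is entrywise.)
  Lemma \<open>ordered_prod_eq_interval\<close> below shows that it agrees with the product over any
  integer interval containing all the nontrivial factors.\<close>

definition ordered_prod :: "(int \<Rightarrow> complex^2^2) \<Rightarrow> complex^2^2" where
  "ordered_prod M = foldr (\<lambda>n P. M n ** P) (sorted_list_of_set {n. M n \<noteq> mat 1}) (mat 1)"

definition su11_product :: "(int \<Rightarrow> complex) \<Rightarrow> real \<Rightarrow> complex^2^2" where
  "su11_product F t = ordered_prod (su11_factor F t)"

definition su11_a :: "(int \<Rightarrow> complex) \<Rightarrow> real \<Rightarrow> complex" where
  "su11_a F t = su11_product F t $ 1 $ 1"

text \<open>The norms below have their usual meaning when the sum converges, the sequence is bounded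
  and the integrand is integrable, respectively; otherwise they take unspecified or junk values.
  Finitely supported sequences satisfy the first two conditions; for the third, see
  lemma \<open>integrable_log_su11_a\<close>.\<close>

definition lp_norm :: "real \<Rightarrow> (int \<Rightarrow> 'a::real_normed_vector) \<Rightarrow> real" where
  "lp_norm p f = (\<Sum>\<^sub>\<infinity>n. norm (f n) powr p) powr (1 / p)"

definition linf_norm :: "(int \<Rightarrow> 'a::real_normed_vector) \<Rightarrow> real" where
  "linf_norm f = (SUP n. norm (f n))"

text \<open>A function on \<open>\<real>/\<int>\<close> is represented by a function on the real line, of which only the
  values on the fundamental domain \<open>[0,1)\<close> matter.\<close>

definition Lq_norm_torus :: "real \<Rightarrow> (real \<Rightarrow> real) \<Rightarrow> real" where
  "Lq_norm_torus q f = (LINT t:{0..<1}|lborel. \<bar>f t\<bar> powr q) powr (1 / q)"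

lemma foldr_mat_filter:
  fixes M :: "int \<Rightarrow> complex^2^2"
  shows "foldr (\<lambda>n P. M n ** P) (filter (\<lambda>n. M n \<noteq> mat 1) ns) (mat 1)
       = foldr (\<lambda>n P. M n ** P) ns (mat 1)"
  by (induction ns) auto

lemma ordered_prod_eq_interval:
  assumes "{n. M n \<noteq> mat 1} \<subseteq> {k..m}"
  shows "ordered_prod M = foldr (\<lambda>n P. M n ** P) [k..m] (mat 1)"
proof -
  have "set (filter (\<lambda>n. M n \<noteq> mat 1) [k..m]) = {n. M n \<noteq> mat 1}"
    using assms by auto
  moreover have "sorted_wrt (<) (filter (\<lambda>n. M n \<noteq> mat 1) [k..m])"
    by (rule sorted_wrt_filter) simp
  ultimately have "sorted_list_of_set {n. M n \<noteq> mat 1} = filter (\<lambda>n. M n \<noteq> mat 1) [k..m]"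
    by (metis sorted_list_of_set.idem_if_sorted_distinct strict_sorted_iff)
  then show ?thesis
    unfolding ordered_prod_def by (simp add: foldr_mat_filter)
qed

lemma su11_factor_eq_mat_1: "F n = 0 \<Longrightarrow> su11_factor F t n = mat 1"
  by (simp add: su11_factor_def coeff_A_def coeff_B_def vec_eq_iff mat_def forall_2)

lemma su11_product_eq_interval:
  assumes "{n. F n \<noteq> 0} \<subseteq> {k..m}"
  shows "su11_product F t = foldr (\<lambda>n P. su11_factor F t n ** P) [k..m] (mat 1)"
  unfolding su11_product_def
  using assms su11_factor_eq_mat_1 by (intro ordered_prod_eq_interval) blast

definition is_su11 :: "complex^2^2 \<Rightarrow> bool" where
  "is_su11 P \<longleftrightarrow> P $ 2 $ 1 = cnj (P $ 1 $ 2) \<and> P $ 2 $ 2 = cnj (P $ 1 $ 1)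
     \<and> (cmod (P $ 1 $ 1))\<^sup>2 - (cmod (P $ 1 $ 2))\<^sup>2 = 1"

lemma is_su11_iff_det:
  "is_su11 P \<longleftrightarrow> P $ 2 $ 1 = cnj (P $ 1 $ 2) \<and> P $ 2 $ 2 = cnj (P $ 1 $ 1) \<and> det P = 1"
proof -
  have "(cmod z)\<^sup>2 - (cmod w)\<^sup>2 = 1 \<longleftrightarrow> z * cnj z - w * cnj w = 1" for z w
  proof -
    have "z * cnj z - w * cnj w = of_real ((cmod z)\<^sup>2 - (cmod w)\<^sup>2)"
      by (simp only: complex_norm_square of_real_diff)
    then show ?thesis
      by (simp only: of_real_eq_1_iff)
  qed
  then show ?thesis
    by (auto simp: is_su11_def det_2)
qed

lemma is_su11_mult: "is_su11 P \<Longrightarrow> is_su11 Q \<Longrightarrow> is_su11 (P ** Q)"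
  unfolding is_su11_iff_det
  by (auto simp: det_mul) (auto simp: matrix_matrix_mult_def sum_2 algebra_simps)

lemma is_su11_factor:
  assumes "cmod (F n) < 1"
  shows "is_su11 (su11_factor F t n)"
proof -
  have *: "0 < 1 - (cmod (F n))\<^sup>2"
    using assms by (simp add: power_less_one_iff)
  then have "(coeff_A F n)\<^sup>2 - (cmod (coeff_B F n))\<^sup>2 = 1"
    by (simp add: coeff_A_def coeff_B_def norm_divide power_divide flip: diff_divide_distrib)
  then show ?thesis
    by (simp add: is_su11_def su11_factor_def norm_mult cis_cnj)
qed

lemma finite_subset_int_interval: "finite (S :: int set) \<Longrightarrow> \<exists>k m. S \<subseteq> {k..m}"
  by (metis atLeastAtMost_iff Max_ge Min_le subsetI)

lemma is_su11_product:
  assumes "\<And>n. cmod (F n) < 1" "finite {n. F n \<noteq> 0}"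
  shows "is_su11 (su11_product F t)"
proof -
  obtain k m where km: "{n. F n \<noteq> 0} \<subseteq> {k..m}"
    using finite_subset_int_interval[OF assms(2)] by blast
  have "is_su11 (foldr (\<lambda>n P. su11_factor F t n ** P) ns (mat 1))" for ns
    by (induction ns) (auto simp: is_su11_mult is_su11_factor assms(1), simp add: is_su11_def mat_def)
  then show ?thesis
    by (simp add: su11_product_eq_interval[OF km])
qed

lemma cmod_su11_a_ge_1:
  assumes "\<And>n. cmod (F n) < 1" "finite {n. F n \<noteq> 0}"
  shows "cmod (su11_a F t) \<ge> 1"
proof -
  have "1 \<le> (cmod (su11_a F t))\<^sup>2"
    using is_su11_product[OF assms, of t] unfolding is_su11_def su11_a_def
    by (smt (verit) zero_le_power2)
  then show ?thesis
    by (metis abs_norm_cancel abs_square_less_1 not_le)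
qed

lemma continuous_on_su11_product:
  assumes "finite {n. F n \<noteq> 0}"
  shows "continuous_on UNIV (\<lambda>t. su11_product F t $ i $ j)"
proof -
  obtain k m where km: "{n. F n \<noteq> 0} \<subseteq> {k..m}"
    using finite_subset_int_interval[OF assms] by blast
  have factor: "continuous_on UNIV (\<lambda>t. su11_factor F t n $ i $ j)" for n i j
    using exhaust_2[of i] exhaust_2[of j]
    by (elim disjE; simp add: su11_factor_def; intro continuous_intros)
  have "continuous_on UNIV (\<lambda>t. foldr (\<lambda>n P. su11_factor F t n ** P) ns (mat 1) $ i $ j)"
    for ns i j
    by (induction ns arbitrary: i j)
       (simp_all add: matrix_matrix_mult_def continuous_on_sum continuous_on_mult factor)
  then show ?thesis
    by (simp add: su11_product_eq_interval[OF km])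
qed

lemma integrable_log_su11_a:
  assumes "\<And>n. cmod (F n) < 1" "finite {n. F n \<noteq> 0}" "q > 0"
  shows "set_integrable lborel {0..<1} (\<lambda>t. \<bar>sqrt (ln ((cmod (su11_a F t))\<^sup>2))\<bar> powr q)"
proof -
  have nz: "su11_a F t \<noteq> 0" for t
    using cmod_su11_a_ge_1[OF assms(1,2), of t] by auto
  have "continuous_on {0..1} (\<lambda>t. \<bar>sqrt (ln ((cmod (su11_a F t))\<^sup>2))\<bar> powr q)"
    using continuous_on_subset[OF continuous_on_su11_product[OF assms(2), of 1 1]] assms(3) nz
    by (intro continuous_on_powr' continuous_intros)
       (auto simp: su11_a_def)
  then have "set_integrable lborel {0..1} (\<lambda>t. \<bar>sqrt (ln ((cmod (su11_a F t))\<^sup>2))\<bar> powr q)"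
    by (rule borel_integrable_atLeastAtMost')
  then show ?thesis
    by (rule set_integrable_subset) auto
qed

end

theory Submission
  imports Defs "HOL-Complex_Analysis.Conformal_Mappings"
begin

text \<open>Since \<open>|a|\<^sup>2 = 1 + |b|\<^sup>2\<close>, \<open>ln (1 + y) \<le> y\<close> and \<open>- ln (1 - y) \<ge> y\<close>, it suffices to bound
  the \<open>L\<^sup>q\<close> norm of \<open>b\<close> by the \<open>\<ell>\<^sup>p\<close> norm of \<open>F\<close>. The linear part of \<open>b\<close> is the exponential sum with
  coefficients \<open>F\<close>; expanding the product, a term of degree \<open>k\<close> with all but one frequency frozen is
  a truncated exponential sum, so the Hausdorff--Young inequality makes the nonlinear part and the
  factor \<open>\<Prod>A\<^sub>n\<close> contribute a relative error \<open>O(\<parallel>F\<parallel>\<^sub>1\<^sup>2)\<close>. This is absorbed by a gain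
  \<open>1 - c \<epsilon>\<^sup>2\<close>, with \<open>\<epsilon> = 1 - \<parallel>F\<parallel>\<^sub>\<infinity> / \<parallel>F\<parallel>\<^sub>p\<close>, in the Hausdorff--Young inequality on the integers;
  hence \<open>\<alpha> = 1\<close> works.

  For \<open>q = 4\<close> the gain is one in Young's inequality: with \<open>h = |F|\<^sup>p\<close> normalized and \<open>u = sqrt h\<close>,
  one has \<open>\<parallel>F * F\<parallel>\<^sub>2\<^sup>2 \<le> \<Sum>(h * h)(u * u)\<close>, where \<open>(u * u)(m)\<close> measures how symmetric \<open>h\<close> is under
  \<open>n \<mapsto> m - n\<close>. On an ordered group the extreme centres of symmetry push all the mass of \<open>h\<close> to a
  single point. The other exponents follow from the three lines theorem, because the analytic family
  joining them leaves \<open>|F|\<^sup>p\<close>, and with it \<open>\<epsilon>\<close>, unchanged on every vertical line. Sampling the circle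
  at \<open>N\<close> equidistant points turns all norms into finite sums, with \<open>N \<longlonglongrightarrow> \<infinity>\<close> taken only at the end.\<close>

section \<open>Near-symmetry of a mass distribution on the integers\<close>

text \<open>The Bhattacharyya coefficient of \<open>h\<close> and its reflection
  \<open>n \<mapsto> m - n\<close>. For a nonnegative mass of total 1 carried by \<open>S\<close> it
  is at most 1, with equality exactly when \<open>h\<close> is symmetric about m/2.\<close>

definition reflection_affinity :: "(int \<Rightarrow> real) \<Rightarrow> int set \<Rightarrow> int \<Rightarrow> real" where
  "reflection_affinity h S m = (\<Sum>n\<in>S. sqrt (h n) * sqrt (h (m - n)))"

text \<open>Reindexing by the reflection. Reflected points outside \<open>S\<close> carry no mass,
  and some points of \<open>S\<close> may not be reached, hence only an inequality.\<close>

lemma sum_reflect_le: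
  fixes h :: "int \<Rightarrow> real"
  assumes "finite S" "\<And>n. h n \<ge> 0" "\<And>n. n \<notin> S \<Longrightarrow> h n = 0"
  shows "(\<Sum>n\<in>{n\<in>S. P n}. h (m - n)) \<le> (\<Sum>n\<in>{n\<in>S. P (m - n)}. h n)"
proof -
  have "(\<Sum>n\<in>{n\<in>S. P n}. h (m - n)) = (\<Sum>j\<in>(\<lambda>n. m - n) ` {n\<in>S. P n}. h j)"
    by (subst sum.reindex) (auto simp: inj_on_def)
  also have "\<dots> = (\<Sum>j\<in>(\<lambda>n. m - n) ` {n\<in>S. P n} \<inter> S. h j)"
    using assms by (intro sum.mono_neutral_right) auto
  also have "\<dots> \<le> (\<Sum>n\<in>{n\<in>S. P (m - n)}. h n)"
    using assms by (intro sum_mono2) auto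
  finally show ?thesis .
qed

text \<open>Expanding the square gives a Hellinger distance; the reflected mass seen inside
  \<open>S\<close> is at most 1.\<close>

lemma reflection_affinity_le_1:
  fixes h :: "int \<Rightarrow> real"
  assumes "finite S" "\<And>n. h n \<ge> 0" "\<And>n. n \<notin> S \<Longrightarrow> h n = 0" "sum h S = 1"
  shows "(\<Sum>n\<in>S. (sqrt (h n) - sqrt (h (m - n)))\<^sup>2) \<le> 2 * (1 - reflection_affinity h S m)"
    and "reflection_affinity h S m \<le> 1"
proof -
  have "(\<Sum>n\<in>S. (sqrt (h n) - sqrt (h (m - n)))\<^sup>2)
      = (\<Sum>n\<in>S. h n + h (m - n) - 2 * (sqrt (h n) * sqrt (h (m - n))))"
    using assms(2) by (intro sum.cong) (auto simp: power2_diff)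
  also have "\<dots> = sum h S + (\<Sum>n\<in>S. h (m - n)) - 2 * reflection_affinity h S m"
    by (simp add: sum.distrib sum_subtractf sum_distrib_left reflection_affinity_def)
  also have "\<dots> \<le> 2 * (1 - reflection_affinity h S m)"
    using sum_reflect_le[where h = h and S = S and P = "\<lambda>_. True" and m = m] assms by simp
  finally show 1: "(\<Sum>n\<in>S. (sqrt (h n) - sqrt (h (m - n)))\<^sup>2) \<le> 2 * (1 - reflection_affinity h S m)" .
  have "0 \<le> (\<Sum>n\<in>S. (sqrt (h n) - sqrt (h (m - n)))\<^sup>2)" by (simp add: sum_nonneg)
  with 1 show "reflection_affinity h S m \<le> 1" by argo
qed

lemma mass_le_reflected_mass:
  fixes h :: "int \<Rightarrow> real"
  assumes "finite S" "\<And>n. h n \<ge> 0" "\<And>n. n \<notin> S \<Longrightarrow> h n = 0" "sum h S = 1"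
  shows "(\<Sum>n\<in>{n\<in>S. P n}. h n)
      \<le> 4 * (1 - reflection_affinity h S m) + 2 * (\<Sum>n\<in>{n\<in>S. P (m - n)}. h n)"
proof -
  have *: "x\<^sup>2 \<le> 2 * (x - y)\<^sup>2 + 2 * y\<^sup>2" for x y :: real
    using zero_le_power2[of "x - 2 * y"] by (simp add: power2_eq_square algebra_simps)
  have "h n \<le> 2 * (sqrt (h n) - sqrt (h (m - n)))\<^sup>2 + 2 * h (m - n)" for n
    using *[of "sqrt (h n)" "sqrt (h (m - n))"] assms(2) by simp
  then have "(\<Sum>n\<in>{n\<in>S. P n}. h n)
      \<le> (\<Sum>n\<in>{n\<in>S. P n}. 2 * (sqrt (h n) - sqrt (h (m - n)))\<^sup>2 + 2 * h (m - n))"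
    by (intro sum_mono)
  also have "\<dots> = 2 * (\<Sum>n\<in>{n\<in>S. P n}. (sqrt (h n) - sqrt (h (m - n)))\<^sup>2)
      + 2 * (\<Sum>n\<in>{n\<in>S. P n}. h (m - n))"
    by (simp add: sum.distrib sum_distrib_left)
  also have "\<dots> \<le> 2 * (\<Sum>n\<in>S. (sqrt (h n) - sqrt (h (m - n)))\<^sup>2)
      + 2 * (\<Sum>n\<in>{n\<in>S. P (m - n)}. h n)"
    using assms sum_reflect_le[OF assms(1-3), where P = P and m = m] by (intro add_mono mult_left_mono sum_mono2) auto
  finally show ?thesis using reflection_affinity_le_1(1)[OF assms, of m] by linarith
qed

text \<open>For most \<open>a\<close> the mass is nearly symmetric about (a + k)/2. The leftmost and
  the rightmost such \<open>a\<close> empty the two sides of \<open>k\<close>; each side costs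
  4\<eta> for the affinity defect and 2\<eta> for the mass outside the set of such \<open>a\<close>,
  which gives 12.\<close>

lemma symmetric_mass_concentrates:
  fixes h :: "int \<Rightarrow> real"
  assumes h: "finite S" "\<And>n. h n \<ge> 0" "\<And>n. n \<notin> S \<Longrightarrow> h n = 0" "sum h S = 1"
    and k: "k \<in> S" and mass: "(\<Sum>a\<in>{a\<in>S. reflection_affinity h S (a + k) \<ge> 1 - \<eta>}. h a) \<ge> 1 - \<eta>"
    and "\<eta> < 1"
  shows "h k \<ge> 1 - 12 * \<eta>"
proof -
  define A where "A = {a\<in>S. reflection_affinity h S (a + k) \<ge> 1 - \<eta>}"
  have fin: "finite A" and sub: "A \<subseteq> S" using h(1) by (auto simp: A_def)
  have "A \<noteq> {}" using mass \<open>\<eta> < 1\<close> by (auto simp flip: A_def)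
  define a b where "a = Min A" and "b = Max A"
  have ab: "a \<in> A" "b \<in> A" "\<And>n. n \<in> A \<Longrightarrow> a \<le> n \<and> n \<le> b"
    using fin \<open>A \<noteq> {}\<close> by (auto simp: a_def b_def)
  have out: "(\<Sum>n\<in>T. h n) \<le> \<eta>" if "T \<subseteq> S - A" for T
  proof -
    have "(\<Sum>n\<in>T. h n) \<le> (\<Sum>n\<in>S - A. h n)" using h that by (intro sum_mono2) auto
    also have "\<dots> = 1 - sum h A" using h sub by (simp add: sum_diff fin)
    finally show ?thesis using mass by (simp flip: A_def)
  qed
  \<comment> \<open>The reflection \<open>n \<mapsto> a + k - n\<close> carries the mass beyond \<open>k\<close> to points left of \<open>A\<close>, where there is
    almost none; \<open>n \<mapsto> b + k - n\<close> does the same for the other side.\<close>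
  have "(\<Sum>n\<in>{n\<in>S. n > k}. h n)
      \<le> 4 * (1 - reflection_affinity h S (a + k)) + 2 * (\<Sum>n\<in>{n\<in>S. a + k - n > k}. h n)"
    by (rule mass_le_reflected_mass[OF h])
  moreover have "(\<Sum>n\<in>{n\<in>S. a + k - n > k}. h n) \<le> \<eta>"
    by (rule out) (use ab(3) in force)
  moreover have "reflection_affinity h S (a + k) \<ge> 1 - \<eta>" using ab(1) by (simp add: A_def)
  ultimately have gt: "(\<Sum>n\<in>{n\<in>S. n > k}. h n) \<le> 6 * \<eta>" by argo
  have "(\<Sum>n\<in>{n\<in>S. n < k}. h n)
      \<le> 4 * (1 - reflection_affinity h S (b + k)) + 2 * (\<Sum>n\<in>{n\<in>S. b + k - n < k}. h n)"
    by (rule mass_le_reflected_mass[OF h])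
  moreover have "(\<Sum>n\<in>{n\<in>S. b + k - n < k}. h n) \<le> \<eta>"
    by (rule out) (use ab(3) in force)
  moreover have "reflection_affinity h S (b + k) \<ge> 1 - \<eta>" using ab(2) by (simp add: A_def)
  ultimately have lt: "(\<Sum>n\<in>{n\<in>S. n < k}. h n) \<le> 6 * \<eta>" by argo
  have "S = insert k ({n\<in>S. n > k} \<union> {n\<in>S. n < k})" using k by auto
  then have "sum h S = h k + sum h ({n\<in>S. n > k} \<union> {n\<in>S. n < k})"
    using h(1) by (metis (no_types, lifting) Un_iff finite_insert less_irrefl mem_Collect_eq sum.insert)
  also have "sum h ({n\<in>S. n > k} \<union> {n\<in>S. n < k}) = sum h {n\<in>S. n > k} + sum h {n\<in>S. n < k}"
    using h(1) by (intro sum.union_disjoint) auto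
  finally show ?thesis using gt lt h(4) by linarith
qed

text \<open>For fixed \<open>b\<close>, the bound \<open>max\<close> forbids concentration at
  \<open>b\<close> when \<epsilon> > 0, so more than \<eta> of the mass sits at points
  \<open>a\<close> with affinity below 1 - \<eta>. This costs \<eta>^2 in the average.\<close>

lemma affinity_average_le:
  fixes h :: "int \<Rightarrow> real"
  assumes h: "finite S" "\<And>n. h n \<ge> 0" "\<And>n. n \<notin> S \<Longrightarrow> h n = 0" "sum h S = 1"
    and \<epsilon>: "0 \<le> \<epsilon>" "\<epsilon> \<le> 1" and max: "\<And>n. h n \<le> 1 - \<epsilon>"
  shows "(\<Sum>a\<in>S. \<Sum>b\<in>S. h a * h b * reflection_affinity h S (a + b)) \<le> 1 - \<epsilon>\<^sup>2 / 169"
proof -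
  let ?r = "reflection_affinity h S"
  \<comment> \<open>With 13 instead of 12, concentration would give a mass of at least 1 - 12\<eta>,
    strictly above 1 - \<epsilon> once \<epsilon> > 0. Its square is the 169 of the claim.\<close>
  define \<eta> where "\<eta> = \<epsilon> / 13"
  have inner: "(\<Sum>a\<in>S. h a * ?r (a + b)) \<le> 1 - \<eta> * \<eta>" if "b \<in> S" for b
  proof (cases "\<epsilon> = 0")
    case True
    have "(\<Sum>a\<in>S. h a * ?r (a + b)) \<le> (\<Sum>a\<in>S. h a * 1)"
      by (intro sum_mono mult_left_mono reflection_affinity_le_1(2)[OF h] h(2))
    then show ?thesis using h True by (simp add: \<eta>_def)
  next
    case False
    define A where "A = {a\<in>S. ?r (a + b) \<ge> 1 - \<eta>}"
    have A: "sum h A < 1 - \<eta>"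
    proof (rule ccontr)
      assume "\<not> ?thesis"
      then have "h b \<ge> 1 - 12 * \<eta>"
        using \<epsilon> by (intro symmetric_mass_concentrates[OF h that]) (auto simp: A_def \<eta>_def)
      then show False using max[of b] \<epsilon> False by (simp add: \<eta>_def)
    qed
    have sub: "A \<subseteq> S" by (auto simp: A_def)
    then have finA: "finite A" using h(1) finite_subset by blast
    have "(\<Sum>a\<in>S. h a * ?r (a + b)) = (\<Sum>a\<in>S - A. h a * ?r (a + b)) + (\<Sum>a\<in>A. h a * ?r (a + b))"
      using sub h(1) by (rule sum.subset_diff)
    also have "\<dots> \<le> (\<Sum>a\<in>S - A. h a * (1 - \<eta>)) + (\<Sum>a\<in>A. h a * 1)"
      by (intro add_mono sum_mono mult_left_mono reflection_affinity_le_1(2)[OF h] h(2))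
        (auto simp: A_def)
    also have "\<dots> = (1 - sum h A) * (1 - \<eta>) + sum h A"
      using sub h finA by (simp add: sum_diff flip: sum_distrib_right)
    also have "\<dots> = 1 - \<eta> * (1 - sum h A)" by (simp add: algebra_simps)
    also have "\<dots> \<le> 1 - \<eta> * \<eta>" using A \<epsilon> mult_left_mono[of \<eta> "1 - sum h A" \<eta>] by (simp add: \<eta>_def)
    finally show ?thesis .
  qed
  have "(\<Sum>a\<in>S. \<Sum>b\<in>S. h a * h b * ?r (a + b)) = (\<Sum>b\<in>S. h b * (\<Sum>a\<in>S. h a * ?r (a + b)))"
    by (subst sum.swap) (simp add: sum_distrib_left mult_ac)
  also have "\<dots> \<le> (\<Sum>b\<in>S. h b * (1 - \<eta> * \<eta>))"
    by (intro sum_mono mult_left_mono inner h(2))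
  also have "\<dots> = 1 - \<epsilon>\<^sup>2 / 169"
    using h(4) by (simp add: \<eta>_def power2_eq_square flip: sum_distrib_right)
  finally show ?thesis .
qed

section \<open>Exponential sums sampled on a grid\<close>

definition exp_sum :: "(int \<Rightarrow> complex) \<Rightarrow> int set \<Rightarrow> real \<Rightarrow> complex" where
  "exp_sum F S t = (\<Sum>n\<in>S. F n * cis (2 * pi * of_int n * t))"

text \<open>A full geometric sum of an \<open>N\<close>-th root of unity other than 1.\<close>

lemma sum_cis_grid:
  assumes "N > 0" "\<not> int N dvd m"
  shows "(\<Sum>j<N. cis (2 * pi * of_int m * (real j / real N))) = 0"
proof -
  define w where "w = cis (2 * pi * of_int m / real N)"
  have "w \<noteq> 1"
  proof
    assume "w = 1"
    then have "cos (2 * pi * of_int m / real N) = 1" unfolding w_def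
      by (metis cis.sel(1) one_complex.sel(1))
    then obtain n :: int where "2 * pi * of_int m / real N = of_int n * 2 * pi"
      using cos_one_2pi_int by auto
    then have "real_of_int m = real_of_int (n * int N)"
      using assms(1) by (simp add: field_simps)
    then have "m = n * int N" by linarith
    then show False using assms(2) by simp
  qed
  have "w ^ N = cis (2 * pi * of_int m)"
    using assms(1) by (simp add: w_def Complex.DeMoivre)
  also have "\<dots> = 1" by (simp add: cis_multiple_2pi)
  finally have "w ^ N = 1" .
  have "(\<Sum>j<N. cis (2 * pi * of_int m * (real j / real N))) = (\<Sum>j<N. w ^ j)"
    by (intro sum.cong) (auto simp: w_def Complex.DeMoivre mult_ac)
  also have "\<dots> = 0" using \<open>w \<noteq> 1\<close> \<open>w ^ N = 1\<close> by (simp add: sum_gp_strict)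
  finally show ?thesis .
qed

text \<open>Distinct frequencies in \<open>S\<close> stay distinct modulo \<open>N\<close>, so no
  aliasing occurs and the sampled characters remain orthogonal.\<close>

lemma Parseval_grid:
  assumes "N > 0" "finite S" and inj: "\<And>m n. m \<in> S \<Longrightarrow> n \<in> S \<Longrightarrow> int N dvd m - n \<Longrightarrow> m = n"
  shows "(\<Sum>j<N. (cmod (exp_sum G S (real j / real N)))\<^sup>2) / real N = (\<Sum>m\<in>S. (cmod (G m))\<^sup>2)"
proof -
  have "complex_of_real (\<Sum>j<N. (cmod (exp_sum G S (real j / real N)))\<^sup>2)
     = (\<Sum>j<N. exp_sum G S (real j / real N) * cnj (exp_sum G S (real j / real N)))"
    by (simp only: of_real_sum complex_norm_square)
  also have "\<dots> = (\<Sum>j<N. \<Sum>m\<in>S. \<Sum>n\<in>S. G m * cnj (G n) * cis (2 * pi * of_int (m - n) * (real j / real N)))"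
    by (intro sum.cong) (auto simp: exp_sum_def sum_product cis_cnj mult_ac cis_mult algebra_simps intro!: sum.cong)
  also have "\<dots> = (\<Sum>m\<in>S. \<Sum>n\<in>S. \<Sum>j<N. G m * cnj (G n) * cis (2 * pi * of_int (m - n) * (real j / real N)))"
    by (subst sum.swap, rule sum.cong, rule refl, rule sum.swap)
  also have "\<dots> = (\<Sum>m\<in>S. \<Sum>n\<in>S. if n = m then G m * cnj (G m) * of_nat N else 0)"
  proof (intro sum.cong refl)
    fix m n assume mn: "m \<in> S" "n \<in> S"
    show "(\<Sum>j<N. G m * cnj (G n) * cis (2 * pi * of_int (m - n) * (real j / real N)))
      = (if n = m then G m * cnj (G m) * of_nat N else 0)"
      using sum_cis_grid[OF assms(1), of "m - n"] inj[OF mn] by (auto simp flip: sum_distrib_left)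
  qed
  also have "\<dots> = complex_of_real (real N * (\<Sum>m\<in>S. (cmod (G m))\<^sup>2))"
    using assms(2) by (simp only: of_real_mult of_real_sum complex_norm_square sum_distrib_left)
      (simp add: mult_ac)
  finally have "(\<Sum>j<N. (cmod (exp_sum G S (real j / real N)))\<^sup>2) = real N * (\<Sum>m\<in>S. (cmod (G m))\<^sup>2)"
    using of_real_eq_iff by blast
  then show ?thesis using assms(1) by simp
qed

text \<open>Substitution m = a + b. The range from 2k to 2l contains every such sum and does not
  depend on \<open>a\<close>, so that the order of summation can be exchanged afterwards.\<close>

lemma sum_shift_interval:
  fixes f c :: "int \<Rightarrow> 'a::semiring_0"
  assumes "a \<in> {k..l}" "\<And>n. n \<notin> {k..l} \<Longrightarrow> f n = 0"
  shows "(\<Sum>b\<in>{k..l}. f b * c (a + b)) = (\<Sum>m\<in>{2*k..2*l}. f (m - a) * c m)"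
proof -
  have "(\<Sum>m\<in>{2*k..2*l}. f (m - a) * c m) = (\<Sum>m\<in>{k+a..l+a}. f (m - a) * c m)"
    using assms by (intro sum.mono_neutral_right) auto
  also have "\<dots> = (\<Sum>b\<in>{k..l}. f b * c (a + b))"
    by (rule sum.reindex_bij_witness[of _ "\<lambda>b. b + a" "\<lambda>m. m - a"]) auto
  finally show ?thesis by simp
qed

lemma exp_sum_square:
  assumes "\<And>n. n \<notin> {k..l} \<Longrightarrow> F n = 0"
  shows "(exp_sum F {k..l} t)\<^sup>2 = exp_sum (\<lambda>m. \<Sum>a\<in>{k..l}. F a * F (m - a)) {2*k..2*l} t"
proof -
  let ?e = "\<lambda>m::int. cis (2 * pi * of_int m * t)"
  have "(exp_sum F {k..l} t)\<^sup>2 = (\<Sum>a\<in>{k..l}. F a * (\<Sum>b\<in>{k..l}. F b * ?e (a + b)))"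
    by (simp add: exp_sum_def power2_eq_square sum_product sum_distrib_left mult_ac cis_mult algebra_simps)
  also have "\<dots> = (\<Sum>a\<in>{k..l}. F a * (\<Sum>m\<in>{2*k..2*l}. F (m - a) * ?e m))"
    using assms by (intro sum.cong refl arg_cong2[where f = "(*)"] sum_shift_interval) auto
  also have "\<dots> = (\<Sum>m\<in>{2*k..2*l}. \<Sum>a\<in>{k..l}. F a * F (m - a) * ?e m)"
    by (simp add: sum_distrib_left mult.assoc) (rule sum.swap)
  finally show ?thesis by (simp add: exp_sum_def sum_distrib_right)
qed

text \<open>The case p = 4/3, q = 4, normalized by \<open>sum h {k..l} = 1\<close>. The fourth power
  is the square of an exponential sum with coefficients F * F, whose frequencies differ by at most
  2(l - k) < N, so Parseval applies. Cauchy-Schwarz bounds |F * F|^2 by h * h times the affinity,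
  and summing gives the average of \<open>affinity_average_le\<close>.\<close>

lemma fourth_power_mean_le:
  fixes h :: "int \<Rightarrow> real"
  assumes N: "2 * (l - k) < int N"
    and h: "\<And>n. h n \<ge> 0" "\<And>n. n \<notin> {k..l} \<Longrightarrow> h n = 0" "sum h {k..l} = 1"
    and \<epsilon>: "0 \<le> \<epsilon>" "\<epsilon> \<le> 1" and max: "\<And>n. h n \<le> 1 - \<epsilon>"
    and F: "\<And>n. cmod (F n) = h n powr (3/4)"
  shows "(\<Sum>j<N. cmod (exp_sum F {k..l} (real j / real N)) ^ 4) / real N \<le> 1 - \<epsilon>\<^sup>2 / 169"
proof -
  let ?S = "{k..l}" and ?Z = "{2*k..2*l}"
  let ?r = "reflection_affinity h ?S"
  define G where "G = (\<lambda>m. \<Sum>a\<in>?S. F a * F (m - a))"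
  have "k \<le> l" using h(3) by (cases "k \<le> l") auto
  then have "N > 0" using N by simp
  have F0: "F n = 0" if "n \<notin> ?S" for n using F[of n] h(2)[OF that] by simp
  have conv: "(cmod (G m))\<^sup>2 \<le> (\<Sum>a\<in>?S. h a * h (m - a)) * ?r m" for m
  proof -
    let ?x = "\<lambda>a. h a * h (m - a)"
    \<comment> \<open>The split 3/4 = 1/2 + 1/4 is chosen so that the squares of the first factors
      sum to h * h and those of the second factors to the affinity.\<close>
    have "cmod (G m) \<le> (\<Sum>a\<in>?S. ?x a powr (1/2) * ?x a powr (1/4))"
      unfolding G_def
    proof (rule sum_norm_le)
      fix a
      have "cmod (F a * F (m - a)) = ?x a powr (3/4)"
        using h(1) by (simp add: F norm_mult powr_mult)
      also have "\<dots> = ?x a powr (1/2) * ?x a powr (1/4)"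
        by (simp flip: powr_add)
      finally show "cmod (F a * F (m - a)) \<le> ?x a powr (1/2) * ?x a powr (1/4)" by simp
    qed
    then have "(cmod (G m))\<^sup>2 \<le> (\<Sum>a\<in>?S. ?x a powr (1/2) * ?x a powr (1/4))\<^sup>2"
      by (simp add: power_mono)
    also have "\<dots> \<le> (\<Sum>a\<in>?S. (?x a powr (1/2))\<^sup>2) * (\<Sum>a\<in>?S. (?x a powr (1/4))\<^sup>2)"
      by (rule Cauchy_Schwarz_ineq_sum)
    also have "(\<Sum>a\<in>?S. (?x a powr (1/2))\<^sup>2) = (\<Sum>a\<in>?S. ?x a)"
      using h(1) by (intro sum.cong) (auto simp: power2_eq_square simp flip: powr_add)
    also have "(\<Sum>a\<in>?S. (?x a powr (1/4))\<^sup>2) = ?r m"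
      unfolding reflection_affinity_def
      using h(1) by (intro sum.cong)
        (auto simp: power2_eq_square powr_half_sqrt real_sqrt_mult simp flip: powr_add)
    finally show ?thesis .
  qed
  have "(\<Sum>j<N. cmod (exp_sum F ?S (real j / real N)) ^ 4) / real N
      = (\<Sum>j<N. (cmod (exp_sum G ?Z (real j / real N)))\<^sup>2) / real N"
  proof -
    have "cmod (exp_sum F ?S t) ^ 4 = (cmod (exp_sum G ?Z t))\<^sup>2" for t
      unfolding G_def using F0 by (subst exp_sum_square[symmetric]) (auto simp: norm_power simp flip: power_mult)
    then show ?thesis by simp
  qed
  also have "\<dots> = (\<Sum>m\<in>?Z. (cmod (G m))\<^sup>2)"
  proof (rule Parseval_grid[OF \<open>N > 0\<close>])
    fix m n assume *: "m \<in> ?Z" "n \<in> ?Z" "int N dvd m - n"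
    have "\<bar>m - n\<bar> < int N" using * N by auto
    then show "m = n" using *(3) zdvd_not_zless[of "\<bar>m - n\<bar>" "int N"] by force
  qed simp
  also have "\<dots> \<le> (\<Sum>m\<in>?Z. (\<Sum>a\<in>?S. h a * h (m - a)) * ?r m)"
    by (intro sum_mono conv)
  also have "\<dots> = (\<Sum>a\<in>?S. h a * (\<Sum>m\<in>?Z. h (m - a) * ?r m))"
    by (simp add: sum_distrib_left sum_distrib_right mult.assoc) (rule sum.swap)
  also have "\<dots> = (\<Sum>a\<in>?S. h a * (\<Sum>b\<in>?S. h b * ?r (a + b)))"
    using h(2) by (intro sum.cong refl arg_cong2[where f = "(*)"] sum_shift_interval[symmetric]) auto
  also have "\<dots> = (\<Sum>a\<in>?S. \<Sum>b\<in>?S. h a * h b * ?r (a + b))"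
    by (simp add: sum_distrib_left mult.assoc)
  also have "\<dots> \<le> 1 - \<epsilon>\<^sup>2 / 169"
    by (rule affinity_average_le) (use h \<epsilon> max in auto)
  finally show ?thesis .
qed

section \<open>The three lines theorem\<close>

text \<open>Multiplying by exp(e z^2) with e > 0 forces decay along vertical lines, so the maximum
  modulus principle on a tall rectangle suffices. The bound exp(e R) obtained there becomes 1 as e
  tends to 0.\<close>

lemma three_lines_unit:
  fixes g :: "complex \<Rightarrow> complex"
  assumes hol: "g holomorphic_on UNIV"
    and bdd: "\<And>z. x0 \<le> Re z \<Longrightarrow> Re z \<le> x1 \<Longrightarrow> cmod (g z) \<le> B"
    and lines: "\<And>z. Re z = x0 \<or> Re z = x1 \<Longrightarrow> cmod (g z) \<le> 1"
    and z0: "x0 \<le> Re z0" "Re z0 \<le> x1"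
  shows "cmod (g z0) \<le> 1"
proof -
  define R where "R = x0\<^sup>2 + x1\<^sup>2"
  have sq: "x\<^sup>2 \<le> R" if x: "x0 \<le> x" "x \<le> x1" for x
  proof -
    have "\<bar>x\<bar> \<le> max \<bar>x0\<bar> \<bar>x1\<bar>" using x by linarith
    then have "x\<^sup>2 \<le> (max \<bar>x0\<bar> \<bar>x1\<bar>)\<^sup>2" by (metis abs_ge_zero power2_abs power_mono)
    also have "\<dots> \<le> R" by (simp add: max_def R_def)
    finally show ?thesis .
  qed
  have B: "B \<ge> 0" using bdd[OF z0] norm_ge_zero order_trans by blast
  have main: "cmod (g z0) \<le> exp (e * (R - (Re z0)\<^sup>2 + (Im z0)\<^sup>2))" if "e > 0" for e
  proof -
    define f where "f = (\<lambda>z. g z * exp (of_real e * z\<^sup>2))"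
    \<comment> \<open>The height places \<open>z0\<close> in the rectangle and ensures B <= eY <=
      eY^2 <= exp(eY^2), so the Gaussian decay absorbs \<open>B\<close> on the horizontal
      sides.\<close>
    define Y where "Y = max (\<bar>Im z0\<bar>) (max 1 (B / e))"
    have Y: "\<bar>Im z0\<bar> \<le> Y" "1 \<le> Y" "B / e \<le> Y" by (auto simp: Y_def)
    have normf: "cmod (f z) = cmod (g z) * exp (e * ((Re z)\<^sup>2 - (Im z)\<^sup>2))" for z
      by (simp add: f_def norm_mult power2_eq_square)
    have holf: "f holomorphic_on UNIV"
      unfolding f_def by (intro holomorphic_intros hol)
    have BY: "B \<le> exp (e * Y\<^sup>2)"
    proof -
      have "B \<le> e * Y" using Y(3) that by (simp add: field_simps)
      also have "\<dots> \<le> e * Y\<^sup>2" using Y(2) that by (simp add: self_le_power)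
      also have "\<dots> \<le> exp (e * Y\<^sup>2)" using exp_ge_add_one_self[of "e * Y\<^sup>2"] by linarith
      finally show ?thesis .
    qed
    have "cmod (f z0) \<le> exp (e * R)"
    proof (rule maximum_modulus_frontier[where f = f and \<xi> = z0 and S = "cbox (Complex x0 (-Y)) (Complex x1 Y)"])
      show "f holomorphic_on interior (cbox (Complex x0 (-Y)) (Complex x1 Y))"
        using holf holomorphic_on_subset by blast
      show "continuous_on (closure (cbox (Complex x0 (-Y)) (Complex x1 Y))) f"
        using holf holomorphic_on_imp_continuous_on continuous_on_subset by blast
      show "bounded (cbox (Complex x0 (-Y)) (Complex x1 Y))" by (rule bounded_cbox)
      show "z0 \<in> cbox (Complex x0 (-Y)) (Complex x1 Y)"
        using z0 Y(1) by (auto simp: in_cbox_complex_iff)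
      fix z assume "z \<in> frontier (cbox (Complex x0 (-Y)) (Complex x1 Y))"
      then have z: "x0 \<le> Re z" "Re z \<le> x1" "- Y \<le> Im z" "Im z \<le> Y"
        and "Re z = x0 \<or> Re z = x1 \<or> Im z = Y \<or> Im z = - Y"
        by (auto simp: frontier_def interior_cbox in_cbox_complex_iff in_box_complex_iff)
      then consider "Re z = x0 \<or> Re z = x1" | "(Im z)\<^sup>2 = Y\<^sup>2" by fastforce
      then show "cmod (f z) \<le> exp (e * R)"
      proof cases
        case 1
        have "cmod (f z) \<le> 1 * exp (e * R)"
          unfolding normf using lines[OF 1] sq[OF z(1,2)] that
          by (intro mult_mono) (auto intro: order_trans[of _ "(Re z)\<^sup>2"])
        then show ?thesis by simp
      next
        case 2
        have "cmod (f z) \<le> exp (e * Y\<^sup>2) * exp (e * (R - Y\<^sup>2))"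
          unfolding normf 2 using bdd[OF z(1,2)] BY sq[OF z(1,2)] that
          by (intro mult_mono) auto
        then show ?thesis by (simp add: algebra_simps flip: exp_add)
      qed
    qed
    then have "cmod (g z0) \<le> exp (e * R) / exp (e * ((Re z0)\<^sup>2 - (Im z0)\<^sup>2))"
      by (simp add: normf pos_le_divide_eq)
    then show ?thesis by (simp add: algebra_simps flip: exp_diff)
  qed
  let ?C = "R - (Re z0)\<^sup>2 + (Im z0)\<^sup>2"
  have "((\<lambda>e. exp (e * ?C)) \<longlongrightarrow> exp (0 * ?C)) (at_right 0)"
    by (intro tendsto_intros)
  then show ?thesis
    using main by (intro tendsto_lowerbound[of "\<lambda>e. exp (e * ?C)" 1 "at_right 0"])
      (auto simp: eventually_at_right_less intro: eventually_mono[OF eventually_at_right_less])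
qed

text \<open>Dividing by the exponential of the linear interpolation between ln K0 and ln K1 turns
  both boundary bounds into 1. Real frequencies \<open>L i\<close> keep the sum bounded on the
  strip, as the three lines theorem requires.\<close>

lemma exponential_sum_three_lines:
  fixes c :: "'i \<Rightarrow> complex" and L :: "'i \<Rightarrow> real" and I :: "'i set"
  defines "\<Phi> \<equiv> \<lambda>z. \<Sum>i\<in>I. c i * exp (of_real (L i) * z)"
  assumes I: "finite I" and x: "x0 < x1" "x0 \<le> x" "x \<le> x1" and K: "K0 > 0" "K1 > 0"
    and b0: "\<And>y. cmod (\<Phi> (Complex x0 y)) \<le> K0"
    and b1: "\<And>y. cmod (\<Phi> (Complex x1 y)) \<le> K1"
  shows "cmod (\<Phi> (of_real x)) \<le> K0 powr ((x1 - x) / (x1 - x0)) * K1 powr ((x - x0) / (x1 - x0))"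
proof -
  define k where "k = (\<lambda>x. (x1 - x) / (x1 - x0) * ln K0 + (x - x0) / (x1 - x0) * ln K1)"
  define g where "g = (\<lambda>z. \<Phi> z * exp (- ((of_real x1 - z) / of_real (x1 - x0) * of_real (ln K0)
      + (z - of_real x0) / of_real (x1 - x0) * of_real (ln K1))))"
  have normg: "cmod (g z) = cmod (\<Phi> z) * exp (- k (Re z))" for z
    by (simp add: g_def k_def norm_mult flip: of_real_diff)
  have hol: "g holomorphic_on UNIV"
    unfolding g_def \<Phi>_def using x(1) by (intro holomorphic_intros) auto
  define B where "B = (\<Sum>i\<in>I. cmod (c i) * exp (\<bar>L i\<bar> * (\<bar>x0\<bar> + \<bar>x1\<bar>))) * exp (\<bar>ln K0\<bar> + \<bar>ln K1\<bar>)"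
  have "cmod (g (of_real x)) \<le> 1"
  proof (rule three_lines_unit[OF hol, of x0 x1 B])
    fix z assume z: "x0 \<le> Re z" "Re z \<le> x1"
    have "cmod (\<Phi> z) \<le> (\<Sum>i\<in>I. cmod (c i) * exp (\<bar>L i\<bar> * (\<bar>x0\<bar> + \<bar>x1\<bar>)))"
      unfolding \<Phi>_def
    proof (rule sum_norm_le)
      fix i :: 'i
      have "L i * Re z \<le> \<bar>L i\<bar> * \<bar>Re z\<bar>" by (metis abs_ge_self abs_mult)
      also have "\<dots> \<le> \<bar>L i\<bar> * (\<bar>x0\<bar> + \<bar>x1\<bar>)" using z by (intro mult_left_mono) auto
      finally show "cmod (c i * exp (of_real (L i) * z)) \<le> cmod (c i) * exp (\<bar>L i\<bar> * (\<bar>x0\<bar> + \<bar>x1\<bar>))"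
        by (simp add: norm_mult mult_left_mono)
    qed
    moreover have "- k (Re z) \<le> \<bar>ln K0\<bar> + \<bar>ln K1\<bar>"
    proof -
      have s: "\<bar>s * y\<bar> \<le> \<bar>y\<bar>" if "0 \<le> s" "s \<le> 1" for s y :: real
        using that by (simp add: abs_mult mult_left_le_one_le)
      show ?thesis
        using s[of "(x1 - Re z) / (x1 - x0)" "ln K0"] s[of "(Re z - x0) / (x1 - x0)" "ln K1"] x(1) z
        unfolding k_def by (smt (verit, best) divide_nonneg_pos divide_le_eq_1_pos)
    qed
    ultimately show "cmod (g z) \<le> B"
      unfolding normg B_def by (intro mult_mono) (auto intro: sum_nonneg)
  next
    fix z assume z: "Re z = x0 \<or> Re z = x1"
    have "cmod (\<Phi> z) \<le> exp (k (Re z))"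
      using z b0[of "Im z"] b1[of "Im z"] x(1) K by (auto simp: k_def simp flip: complex.expand)
    then show "cmod (g z) \<le> 1"
      by (simp add: normg exp_minus field_simps)
  qed (use x in auto)
  then have "cmod (\<Phi> (of_real x)) \<le> exp (k x)"
    by (simp add: normg exp_minus field_simps)
  also have "exp (k x) = K0 powr ((x1 - x) / (x1 - x0)) * K1 powr ((x - x0) / (x1 - x0))"
    using K by (simp add: k_def powr_def exp_add)
  finally show ?thesis .
qed

text \<open>Riesz-Thorin interpolation: with the phases of \<open>F\<close> and \<open>W\<close>
  fixed and their moduli replaced by the powers h^z and w^z, the bilinear form becomes an
  exponential sum in z with frequencies ln w + ln h. On the line Re z = s the moduli are exactly h^s
  and w^s.\<close>

lemma bilinear_three_lines:
  fixes h :: "int \<Rightarrow> real" and w :: "nat \<Rightarrow> real"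
  assumes S: "finite S" and h: "\<And>n. h n \<ge> 0" and w: "\<And>j. w j \<ge> 0"
    and x: "x0 < x1" "x0 \<le> x" "x \<le> x1" and K: "K0 > 0" "K1 > 0"
    and b0: "\<And>F W. (\<And>n. cmod (F n) = h n powr x0) \<Longrightarrow> (\<And>j. cmod (W j) = w j powr x0) \<Longrightarrow>
      cmod (\<Sum>j<N. W j * exp_sum F S (real j / real N)) \<le> K0"
    and b1: "\<And>F W. (\<And>n. cmod (F n) = h n powr x1) \<Longrightarrow> (\<And>j. cmod (W j) = w j powr x1) \<Longrightarrow>
      cmod (\<Sum>j<N. W j * exp_sum F S (real j / real N)) \<le> K1"
    and F: "\<And>n. cmod (F n) = h n powr x" and W: "\<And>j. cmod (W j) = w j powr x"
  shows "cmod (\<Sum>j<N. W j * exp_sum F S (real j / real N))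
     \<le> K0 powr ((x1 - x) / (x1 - x0)) * K1 powr ((x - x0) / (x1 - x0))"
proof -
  \<comment> \<open>Logarithms are taken only of positive masses. The omitted terms vanish because
    \<open>0 powr s = 0\<close>, even for s = 0.\<close>
  define I where "I = {(j, n). j < N \<and> n \<in> S \<and> h n > 0 \<and> w j > 0}"
  have I: "I \<subseteq> {..<N} \<times> S" by (auto simp: I_def)
  then have "finite I" using S finite_subset by (metis finite_cartesian_product finite_lessThan)
  define L where "L = (\<lambda>(j, n). ln (w j) + ln (h n))"
  define c where "c = (\<lambda>(j, n). sgn (W j) * sgn (F n) * cis (2 * pi * of_int n * (real j / real N)))"
  define \<Phi> where "\<Phi> = (\<lambda>z. \<Sum>i\<in>I. c i * exp (of_real (L i) * z))"
  \<comment> \<open>The phase 1 at zeros of \<open>F\<close> lets the modulus be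
    \<open>h n powr s\<close> at every \<open>n\<close>, as the hypotheses on the two boundary lines
    demand.\<close>
  define FF where "FF = (\<lambda>s y n. (if F n = 0 then 1 else sgn (F n)) * of_real (h n powr s) * cis (y * ln (h n)))"
  define WW where "WW = (\<lambda>s y j. (if W j = 0 then 1 else sgn (W j)) * of_real (w j powr s) * cis (y * ln (w j)))"
  have nFF: "cmod (FF s y n) = h n powr s" for s y n
    by (auto simp: FF_def norm_mult norm_sgn)
  have nWW: "cmod (WW s y j) = w j powr s" for s y j
    by (auto simp: WW_def norm_mult norm_sgn)
  have ex: "exp (of_real (ln a) * Complex s y) = of_real (a powr s) * cis (y * ln a)" if "a > 0" for a s y
    using that by (simp add: exp_eq_polar complex_eq_iff powr_def cis.ctr mult_ac)
  have \<Phi>: "\<Phi> (Complex s y) = (\<Sum>j<N. WW s y j * exp_sum (FF s y) S (real j / real N))" for s y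
  proof -
    have "(\<Sum>j<N. WW s y j * exp_sum (FF s y) S (real j / real N))
       = (\<Sum>(j, n)\<in>{..<N}\<times>S. WW s y j * (FF s y n * cis (2 * pi * of_int n * (real j / real N))))"
      by (simp add: exp_sum_def sum_distrib_left sum.cartesian_product)
    also have "\<dots> = (\<Sum>(j, n)\<in>I. WW s y j * (FF s y n * cis (2 * pi * of_int n * (real j / real N))))"
      using S I h w by (intro sum.mono_neutral_right) (auto simp: I_def FF_def WW_def less_le)
    also have "\<dots> = \<Phi> (Complex s y)"
      unfolding \<Phi>_def
    proof (intro sum.cong refl, clarify)
      fix j n assume "(j, n) \<in> I"
      then have pos: "h n > 0" "w j > 0" by (auto simp: I_def)
      then have nz: "F n \<noteq> 0" "W j \<noteq> 0" using F[of n] W[of j] by auto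
      have "exp (of_real (L (j, n)) * Complex s y)
          = (of_real (w j powr s) * cis (y * ln (w j))) * (of_real (h n powr s) * cis (y * ln (h n)))"
        using pos by (simp add: L_def ring_distribs exp_add ex)
      then show "WW s y j * (FF s y n * cis (2 * pi * of_int n * (real j / real N)))
          = c (j, n) * exp (of_real (L (j, n)) * Complex s y)"
        using nz by (simp add: c_def WW_def FF_def mult_ac)
    qed
    finally show ?thesis ..
  qed
  have "cmod (\<Phi> (Complex x0 y)) \<le> K0" for y
    unfolding \<Phi> by (rule b0) (rule nFF nWW)+
  moreover have "cmod (\<Phi> (Complex x1 y)) \<le> K1" for y
    unfolding \<Phi> by (rule b1) (rule nFF nWW)+
  ultimately have "cmod (\<Phi> (of_real x)) \<le> K0 powr ((x1 - x) / (x1 - x0)) * K1 powr ((x - x0) / (x1 - x0))"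
    unfolding \<Phi>_def by (rule exponential_sum_three_lines[OF \<open>finite I\<close> x K])
  moreover have "FF x 0 n = F n" for n
    unfolding FF_def using F[of n, symmetric] by (simp add: sgn_eq)
  then have "FF x 0 = F" by auto
  moreover have "WW x 0 j = W j" for j
    unfolding WW_def using W[of j, symmetric] by (simp add: sgn_eq)
  then have "WW x 0 = W" by auto
  ultimately show ?thesis
    using \<Phi>[of x 0] by (simp add: complex_of_real_def)
qed

section \<open>The Hausdorff--Young inequality with a gain\<close>

text \<open>For x = 1/p, the powers h^x and w^x are the moduli of coefficients of unit l^p norm and
  of a test function of unit L^p norm on the sample points, p being the exponent dual to q. Fixing
  \<open>h\<close> and \<open>w\<close> while x varies is what interpolation needs.\<close>

context
  fixes k l :: int and N :: nat and h :: "int \<Rightarrow> real" and w :: "nat \<Rightarrow> real"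
  assumes N: "2 * (l - k) < int N"
    and h: "\<And>n. h n \<ge> 0" "\<And>n. n \<notin> {k..l} \<Longrightarrow> h n = 0" "sum h {k..l} = 1"
    and w: "\<And>j. w j \<ge> 0" "sum w {..<N} = real N"
begin

lemma N_pos: "N > 0"
proof -
  have "k \<le> l" using h(3) by (cases "k \<le> l") auto
  then show ?thesis using N by simp
qed

text \<open>The trivial endpoint p = 1, q = \<infinity>.\<close>

lemma bilinear_1:
  assumes F: "\<And>n. cmod (F n) = h n powr 1" and W: "\<And>j. cmod (W j) = w j powr 1"
  shows "cmod (\<Sum>j<N. W j * exp_sum F {k..l} (real j / real N)) \<le> real N"
proof -
  have "cmod (exp_sum F {k..l} t) \<le> sum h {k..l}" for t
    unfolding exp_sum_def using F h(1) by (intro sum_norm_le) (simp add: norm_mult)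
  then have "cmod (\<Sum>j<N. W j * exp_sum F {k..l} (real j / real N)) \<le> (\<Sum>j<N. w j * 1)"
    using W w(1) h(3) by (intro sum_norm_le) (simp add: norm_mult mult_left_le)
  then show ?thesis using w(2) by simp
qed

text \<open>The endpoint p = q = 2, from Parseval and Cauchy-Schwarz.\<close>

lemma bilinear_half:
  assumes F: "\<And>n. cmod (F n) = h n powr (1/2)" and W: "\<And>j. cmod (W j) = w j powr (1/2)"
  shows "cmod (\<Sum>j<N. W j * exp_sum F {k..l} (real j / real N)) \<le> real N"
proof -
  let ?E = "\<lambda>j. exp_sum F {k..l} (real j / real N)"
  have "(\<Sum>j<N. (cmod (?E j))\<^sup>2) / real N = (\<Sum>n\<in>{k..l}. (cmod (F n))\<^sup>2)"
  proof (rule Parseval_grid[OF N_pos])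
    fix m n assume *: "m \<in> {k..l}" "n \<in> {k..l}" "int N dvd m - n"
    have "\<bar>m - n\<bar> < int N" using * N by auto
    then show "m = n" using *(3) zdvd_not_zless[of "\<bar>m - n\<bar>" "int N"] by force
  qed simp
  also have "\<dots> = sum h {k..l}"
    using h(1) by (simp add: F power2_eq_square flip: powr_add)
  finally have E: "(\<Sum>j<N. (cmod (?E j))\<^sup>2) = real N" using h(3) N_pos by simp
  have "(cmod (\<Sum>j<N. W j * ?E j))\<^sup>2 \<le> (\<Sum>j<N. cmod (W j) * cmod (?E j))\<^sup>2"
    by (intro power_mono sum_norm_le) (auto simp: norm_mult)
  also have "\<dots> \<le> (\<Sum>j<N. (cmod (W j))\<^sup>2) * (\<Sum>j<N. (cmod (?E j))\<^sup>2)"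
    by (rule Cauchy_Schwarz_ineq_sum)
  also have "(\<Sum>j<N. (cmod (W j))\<^sup>2) = real N"
    using w by (simp add: W power2_eq_square flip: powr_add)
  also note E
  finally show ?thesis
    using power2_le_imp_le[of _ "real N"] by (simp add: power2_eq_square)
qed

text \<open>Hoelder's inequality with exponents 4/3 and 4, carried out by two applications of
  Cauchy-Schwarz, against the improved fourth-power mean. This is the only exponent at which the
  gain is proved directly.\<close>

lemma bilinear_three_quarters:
  assumes \<epsilon>: "0 \<le> \<epsilon>" "\<epsilon> \<le> 1" and max: "\<And>n. h n \<le> 1 - \<epsilon>"
    and F: "\<And>n. cmod (F n) = h n powr (3/4)" and W: "\<And>j. cmod (W j) = w j powr (3/4)"
  shows "cmod (\<Sum>j<N. W j * exp_sum F {k..l} (real j / real N)) \<le> real N * (1 - \<epsilon>\<^sup>2 / 169) powr (1/4)"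
proof -
  let ?E = "\<lambda>j. cmod (exp_sum F {k..l} (real j / real N))" and ?D = "1 - \<epsilon>\<^sup>2 / 169"
  have D: "?D > 0" using \<epsilon> power_le_one[of \<epsilon> 2] by simp
  have "(\<Sum>j<N. ?E j ^ 4) / real N \<le> ?D"
    by (rule fourth_power_mean_le[OF N h \<epsilon> max F])
  then have E: "(\<Sum>j<N. ?E j ^ 4) \<le> real N * ?D" using N_pos by (simp add: field_simps)
  have w2: "(w j powr (1/2))\<^sup>2 = w j" "(w j powr (1/4))\<^sup>2 = w j powr (1/2)"
    "w j powr (3/4) = w j powr (1/2) * w j powr (1/4)" for j
    using w(1)[of j] by (simp_all add: power2_eq_square flip: powr_add)
  have "(\<Sum>j<N. w j powr (1/2) * (?E j)\<^sup>2)\<^sup>2 \<le> (\<Sum>j<N. (w j powr (1/2))\<^sup>2) * (\<Sum>j<N. ((?E j)\<^sup>2)\<^sup>2)"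
    by (rule Cauchy_Schwarz_ineq_sum)
  also have "\<dots> \<le> real N * (real N * ?D)"
    using E w(2) by (simp add: w2 mult_left_mono flip: power_mult)
  finally have 1: "(\<Sum>j<N. w j powr (1/2) * (?E j)\<^sup>2)\<^sup>2 \<le> real N ^ 2 * ?D"
    by (simp add: power2_eq_square)
  have "cmod (\<Sum>j<N. W j * exp_sum F {k..l} (real j / real N)) \<le> (\<Sum>j<N. w j powr (1/2) * (w j powr (1/4) * ?E j))"
    by (intro sum_norm_le) (simp add: norm_mult W w2 mult.assoc)
  then have "cmod (\<Sum>j<N. W j * exp_sum F {k..l} (real j / real N)) ^ 2
     \<le> (\<Sum>j<N. w j powr (1/2) * (w j powr (1/4) * ?E j)) ^ 2"
    by (rule power_mono) simp
  also have "\<dots> \<le> (\<Sum>j<N. (w j powr (1/2))\<^sup>2) * (\<Sum>j<N. (w j powr (1/4) * ?E j)\<^sup>2)"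
    by (rule Cauchy_Schwarz_ineq_sum)
  also have "\<dots> = real N * (\<Sum>j<N. w j powr (1/2) * (?E j)\<^sup>2)"
    using w(2) by (simp add: power_mult_distrib w2)
  finally have "cmod (\<Sum>j<N. W j * exp_sum F {k..l} (real j / real N)) ^ 2
     \<le> real N * (\<Sum>j<N. w j powr (1/2) * (?E j)\<^sup>2)" .
  then have "(cmod (\<Sum>j<N. W j * exp_sum F {k..l} (real j / real N)) ^ 2) ^ 2
     \<le> (real N * (\<Sum>j<N. w j powr (1/2) * (?E j)\<^sup>2)) ^ 2"
    by (rule power_mono) simp
  also have "\<dots> \<le> real N ^ 2 * (real N ^ 2 * ?D)"
    unfolding power_mult_distrib using 1 by (intro mult_left_mono) auto
  also have "\<dots> = (real N * ?D powr (1/4)) ^ 4"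
  proof -
    have "(?D powr (1/4)) ^ 4 = ?D" using D by (simp add: powr_power)
    then show ?thesis by (simp only: power_mult_distrib) (simp add: power4_eq_xxxx power2_eq_square)
  qed
  finally have "cmod (\<Sum>j<N. W j * exp_sum F {k..l} (real j / real N)) ^ Suc 3
     \<le> (real N * ?D powr (1/4)) ^ Suc 3"
    by (simp only: power_mult[symmetric]) simp
  then show ?thesis by (rule power_le_imp_le_base) simp
qed

text \<open>Interpolation of 3/4 with 1/2 or with 1. The endpoint 3/4 gets weight 4(x - 1/2) or 4(1
  - x), and its gain has exponent 1/4; the minimum selects the product that applies.\<close>

lemma bilinear_deficit:
  assumes \<epsilon>: "0 \<le> \<epsilon>" "\<epsilon> \<le> 1" and max: "\<And>n. h n \<le> 1 - \<epsilon>"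
    and x: "1/2 < x" "x < 1"
    and F: "\<And>n. cmod (F n) = h n powr x" and W: "\<And>j. cmod (W j) = w j powr x"
  shows "cmod (\<Sum>j<N. W j * exp_sum F {k..l} (real j / real N))
     \<le> real N * (1 - \<epsilon>\<^sup>2 / 169) powr (min (x - 1/2) (1 - x))"
proof -
  let ?D = "1 - \<epsilon>\<^sup>2 / 169"
  have D: "?D > 0" "?D \<le> 1" using \<epsilon> power_le_one[of \<epsilon> 2] by simp_all
  note b34 = bilinear_three_quarters[OF \<epsilon> max]
  have K: "real N > 0" "real N * ?D powr (1/4) > 0" using N_pos D by auto
  show ?thesis
  proof (cases "x \<le> 3/4")
    case True
    let ?s = "(x - 1/2) / (3/4 - 1/2)" and ?s' = "(3/4 - x) / (3/4 - 1/2)"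
    have "cmod (\<Sum>j<N. W j * exp_sum F {k..l} (real j / real N))
       \<le> real N powr ?s' * (real N * ?D powr (1/4)) powr ?s"
      by (rule bilinear_three_lines[where h = h and w = w, OF _ h(1) w(1) _ _ _ K bilinear_half b34 F W])
        (use x True in simp_all)
    also have "\<dots> = (real N powr ?s' * real N powr ?s) * ?D powr (x - 1/2)"
    proof -
      have "(?D powr (1/4)) powr ?s = ?D powr (x - 1/2)"
        unfolding powr_powr by (rule arg_cong[where f = "(powr) ?D"]) (simp add: field_simps)
      then show ?thesis by (simp only: powr_mult)
    qed
    also have "real N powr ?s' * real N powr ?s = real N"
      using N_pos by (simp add: diff_divide_distrib flip: powr_add)
    also have "real N * ?D powr (x - 1/2) \<le> real N * ?D powr (min (x - 1/2) (1 - x))"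
      using D by (intro mult_left_mono powr_mono') auto
    finally show ?thesis .
  next
    case False
    let ?s = "(x - 3/4) / (1 - 3/4)" and ?s' = "(1 - x) / (1 - 3/4)"
    have "cmod (\<Sum>j<N. W j * exp_sum F {k..l} (real j / real N))
       \<le> (real N * ?D powr (1/4)) powr ?s' * real N powr ?s"
      by (rule bilinear_three_lines[where h = h and w = w, OF _ h(1) w(1) _ _ _ K(2,1) b34 bilinear_1 F W])
        (use x False in simp_all)
    also have "\<dots> = (real N powr ?s' * real N powr ?s) * ?D powr (1 - x)"
    proof -
      have "(?D powr (1/4)) powr ?s' = ?D powr (1 - x)"
        unfolding powr_powr by (rule arg_cong[where f = "(powr) ?D"]) (simp add: field_simps)
      then show ?thesis by (simp only: powr_mult mult_ac)
    qed
    also have "real N powr ?s' * real N powr ?s = real N"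
      using N_pos by (simp add: diff_divide_distrib flip: powr_add)
    also have "real N * ?D powr (1 - x) \<le> real N * ?D powr (min (x - 1/2) (1 - x))"
      using D by (intro mult_left_mono powr_mono') auto
    finally show ?thesis .
  qed
qed

end

text \<open>Weighted arithmetic-geometric mean inequality for 1 - y and 1.\<close>

lemma one_minus_powr_le:
  fixes y \<theta> :: real
  assumes "0 \<le> y" "y < 1" "0 \<le> \<theta>" "\<theta> \<le> 1"
  shows "(1 - y) powr \<theta> \<le> 1 - \<theta> * y"
proof -
  have "(1 - y) powr \<theta> * 1 powr (1 - \<theta>) \<le> \<theta> * (1 - y) + (1 - \<theta>) * 1"
    using assms by (intro Youngs_inequality_0) auto
  then show ?thesis by (simp add: algebra_simps)
qed

section \<open>Normalized L^q norms over the sample points\<close>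

definition grid_norm :: "nat \<Rightarrow> real \<Rightarrow> (real \<Rightarrow> complex) \<Rightarrow> real" where
  "grid_norm N q f = ((\<Sum>j<N. cmod (f (real j / real N)) powr q) / real N) powr (1 / q)"

lemma grid_norm_nonneg: "grid_norm N q f \<ge> 0"
  by (simp add: grid_norm_def)

lemma grid_norm_le_iff:
  assumes "N > 0" "q > 0" "s \<ge> 0"
  shows "grid_norm N q f \<le> s \<longleftrightarrow> (\<Sum>j<N. cmod (f (real j / real N)) powr q) / real N \<le> s powr q"
proof -
  let ?Q = "(\<Sum>j<N. cmod (f (real j / real N)) powr q) / real N"
  have Q: "?Q \<ge> 0" by (intro divide_nonneg_nonneg sum_nonneg) auto
  show ?thesis
  proof
    assume "grid_norm N q f \<le> s"
    then have "(?Q powr (1 / q)) powr q \<le> s powr q"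
      using assms by (intro powr_mono2) (auto simp: grid_norm_def)
    then show "?Q \<le> s powr q" using Q assms by (simp only: powr_powr) (simp add: sum_nonneg)
  next
    assume "?Q \<le> s powr q"
    then have "?Q powr (1 / q) \<le> (s powr q) powr (1 / q)"
      using Q assms by (intro powr_mono2) auto
    then show "grid_norm N q f \<le> s" using assms by (simp add: grid_norm_def powr_powr)
  qed
qed

text \<open>Convexity of the power; if \<open>x\<close> or \<open>y\<close> vanishes the claim
  reduces to u^q <= u for u in [0, 1].\<close>

lemma powr_convex_combination:
  fixes u v x y q :: real
  assumes "u \<ge> 0" "v \<ge> 0" "u + v = 1" "x \<ge> 0" "y \<ge> 0" "q \<ge> 1"
  shows "(u * x + v * y) powr q \<le> u * x powr q + v * y powr q"
proof -
  have one: "(u * x) powr q \<le> u * x powr q" if "0 \<le> u" "u \<le> 1" "0 \<le> x" for u x :: real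
  proof -
    have "u powr q \<le> u powr 1"
      by (rule powr_mono') (use that assms(6) in auto)
    then show ?thesis using that by (simp add: powr_mult mult_right_mono)
  qed
  consider "x = 0" | "y = 0" | "x > 0" "y > 0" using assms by linarith
  then show ?thesis
  proof cases
    case 3
    have "((1 - v) * x + v * y) powr q \<le> (1 - v) * x powr q + v * y powr q"
      using convex_onD[OF powr_convex[OF assms(6)], of v x y] 3 assms by simp
    moreover have "1 - v = u" using assms(3) by simp
    ultimately show ?thesis by (simp only:)
  qed (use one[of u x] one[of v y] assms in auto)
qed

text \<open>Minkowski's inequality by homogeneity: f + g is s + t times the convex combination of
  f/s and g/t with weights s/(s + t) and t/(s + t). Positive \<open>s\<close> and \<open>t\<close>
  make the quotients meaningful.\<close>

lemma grid_norm_triangle_bound: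
  assumes "N > 0" "q \<ge> 1" and f: "grid_norm N q f \<le> s" and g: "grid_norm N q g \<le> t" and "s > 0" "t > 0"
  shows "grid_norm N q (\<lambda>x. f x + g x) \<le> s + t"
proof -
  let ?x = "\<lambda>j. real j / real N"
  have st: "s + t > 0" using assms by simp
  define \<alpha> where "\<alpha> = (s + t) powr q * (s / (s + t)) / s powr q"
  define \<beta> where "\<beta> = (s + t) powr q * (t / (s + t)) / t powr q"
  have pt: "cmod (f x + g x) powr q \<le> \<alpha> * cmod (f x) powr q + \<beta> * cmod (g x) powr q" for x
  proof -
    have "cmod (f x + g x) powr q \<le> (cmod (f x) + cmod (g x)) powr q"
      using assms by (intro powr_mono2 norm_triangle_ineq) auto
    also have "cmod (f x) + cmod (g x) = (s + t) * (s / (s + t) * (cmod (f x) / s) + t / (s + t) * (cmod (g x) / t))"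
      using assms st by (simp add: distrib_left)
    also have "\<dots> powr q = (s + t) powr q * (s / (s + t) * (cmod (f x) / s) + t / (s + t) * (cmod (g x) / t)) powr q"
      using assms by (simp add: powr_mult)
    also have "\<dots> \<le> (s + t) powr q * (s / (s + t) * (cmod (f x) / s) powr q + t / (s + t) * (cmod (g x) / t) powr q)"
      using assms st by (intro mult_left_mono powr_convex_combination) (auto simp flip: add_divide_distrib)
    also have "\<dots> = \<alpha> * cmod (f x) powr q + \<beta> * cmod (g x) powr q"
      by (simp add: powr_divide distrib_left \<alpha>_def \<beta>_def)
    finally show ?thesis .
  qed
  have F: "(\<Sum>j<N. cmod (f (?x j)) powr q) / real N \<le> s powr q"
    and G: "(\<Sum>j<N. cmod (g (?x j)) powr q) / real N \<le> t powr q"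
    using f g assms grid_norm_le_iff by auto
  have "(\<Sum>j<N. cmod (f (?x j) + g (?x j)) powr q) / real N
     \<le> (\<Sum>j<N. \<alpha> * cmod (f (?x j)) powr q + \<beta> * cmod (g (?x j)) powr q) / real N"
    by (intro divide_right_mono sum_mono pt) auto
  also have "\<dots> = \<alpha> * ((\<Sum>j<N. cmod (f (?x j)) powr q) / real N) + \<beta> * ((\<Sum>j<N. cmod (g (?x j)) powr q) / real N)"
    by (simp add: sum.distrib sum_distrib_left add_divide_distrib)
  also have "\<dots> \<le> \<alpha> * s powr q + \<beta> * t powr q"
    using F G assms st by (intro mult_left_mono add_mono) (auto simp: \<alpha>_def \<beta>_def)
  also have "\<dots> = (s + t) powr q * (s / (s + t) + t / (s + t))"
    using assms by (simp add: \<alpha>_def \<beta>_def distrib_left)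
  also have "\<dots> = (s + t) powr q" using st by (simp flip: add_divide_distrib)
  finally show ?thesis using assms by (simp add: grid_norm_le_iff)
qed

lemma grid_norm_triangle:
  assumes "N > 0" "q \<ge> 1"
  shows "grid_norm N q (\<lambda>x. f x + g x) \<le> grid_norm N q f + grid_norm N q g"
proof (rule field_le_epsilon)
  fix e :: real assume "e > 0"
  \<comment> \<open>Adding e/2 keeps both bounds positive even when a norm is zero.\<close>
  then show "grid_norm N q (\<lambda>x. f x + g x) \<le> grid_norm N q f + grid_norm N q g + e"
    using grid_norm_triangle_bound[OF assms, of f "grid_norm N q f + e / 2" g "grid_norm N q g + e / 2"]
      grid_norm_nonneg[of N q f] grid_norm_nonneg[of N q g] by simp
qed

lemma grid_norm_scale:
  assumes "q > 0" "c \<ge> 0" "\<And>t. cmod (f t) = c * cmod (g t)"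
  shows "grid_norm N q f = c * grid_norm N q g"
proof -
  have "(\<Sum>j<N. cmod (f (real j / real N)) powr q) = c powr q * (\<Sum>j<N. cmod (g (real j / real N)) powr q)"
    using assms by (simp add: powr_mult sum_distrib_left)
  then have "grid_norm N q f = (c powr q * ((\<Sum>j<N. cmod (g (real j / real N)) powr q) / real N)) powr (1 / q)"
    by (simp add: grid_norm_def)
  also have "\<dots> = (c powr q) powr (1 / q) * grid_norm N q g"
    unfolding grid_norm_def by (rule powr_mult)
  finally show ?thesis using assms(1,2) by (simp add: powr_powr)
qed

text \<open>Duality: after normalization, the bilinear form is tested on the function proportional
  to |E|^(q/p) with the conjugate phase of E, and \<open>bilinear_deficit\<close> is applied at x =
  1/p.\<close>

lemma Hausdorff_Young_grid:
  assumes N: "N > 0" "2 * (l - k) < int N" and F0: "\<And>n. n \<notin> {k..l} \<Longrightarrow> F n = 0"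
    and pq: "1 < p" "p < 2" "1 / p + 1 / q = 1" and \<epsilon>: "0 \<le> \<epsilon>" "\<epsilon> \<le> 1"
    and max: "\<And>n. cmod (F n) powr p \<le> (1 - \<epsilon>) * (\<Sum>n\<in>{k..l}. cmod (F n) powr p)"
  shows "grid_norm N q (exp_sum F {k..l})
     \<le> (1 - min (1/p - 1/2) (1 - 1/p) / 169 * \<epsilon>\<^sup>2) * (\<Sum>n\<in>{k..l}. cmod (F n) powr p) powr (1 / p)"
proof -
  define H where "H = (\<Sum>n\<in>{k..l}. cmod (F n) powr p)"
  define \<theta> where "\<theta> = min (1/p - 1/2) (1 - 1/p)"
  define E where "E = (\<lambda>j. exp_sum F {k..l} (real j / real N))"
  define Q where "Q = (\<Sum>j<N. cmod (E j) powr q)"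
  have p1: "1/2 < 1 / p" "1 / p < 1" using pq by (simp_all add: field_simps)
  have q: "q > 0" "q / p + 1 = q"
  proof -
    have q0: "1 / q > 0" using pq(3) p1 by linarith
    then show "q > 0" by simp
    then show "q / p + 1 = q" using pq(1,3) by (simp add: field_simps)
  qed
  have \<theta>: "0 \<le> \<theta>" "\<theta> \<le> 1" using p1 by (auto simp: \<theta>_def)
  have "\<epsilon>\<^sup>2 \<le> 1" using \<epsilon> by (simp add: power_le_one)
  then have "\<theta> * (\<epsilon>\<^sup>2 / 169) \<le> 1 * 1" using \<theta> by (intro mult_mono) auto
  then have nn: "1 - \<theta> / 169 * \<epsilon>\<^sup>2 \<ge> 0" by simp
  have H0: "H \<ge> 0" by (simp add: H_def sum_nonneg)
  have Q0: "Q \<ge> 0" by (simp add: Q_def sum_nonneg)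
  have gn: "grid_norm N q (exp_sum F {k..l}) = (Q / real N) powr (1 / q)"
    by (simp add: grid_norm_def Q_def E_def)
  \<comment> \<open>Normalization divides by \<open>Q\<close> and \<open>H\<close>, so their
    vanishing is treated apart.\<close>
  consider "Q = 0" | "H = 0" | "Q > 0" "H > 0" using H0 Q0 by linarith
  then show ?thesis
  proof cases
    case 1
    then show ?thesis unfolding gn using nn by (simp add: \<theta>_def)
  next
    case 2
    then have "\<And>n. n \<in> {k..l} \<Longrightarrow> F n = 0"
      by (simp add: H_def sum_nonneg_eq_0_iff)
    then have "Q = 0" by (simp add: Q_def E_def exp_sum_def)
    then show ?thesis unfolding gn using nn by (simp add: \<theta>_def)
  next
    case 3
    define h where "h = (\<lambda>n. cmod (F n) powr p / H)"
    define w where "w = (\<lambda>j. real N / Q * cmod (E j) powr q)"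
    define F' where "F' = (\<lambda>n. F n / of_real (H powr (1/p)))"
    \<comment> \<open>the extremal dual function, for which the bilinear form equals the norm\<close>
    define W where "W = (\<lambda>j. cnj (sgn (E j)) * of_real (w j powr (1/p)))"
    have h: "\<And>n. h n \<ge> 0" "\<And>n. n \<notin> {k..l} \<Longrightarrow> h n = 0" "sum h {k..l} = 1" "\<And>n. h n \<le> 1 - \<epsilon>"
      using 3 F0 max by (auto simp: h_def pos_divide_le_eq simp flip: sum_divide_distrib H_def)
    have "sum w {..<N} = real N / Q * Q"
      unfolding w_def Q_def by (rule sum_distrib_left[symmetric])
    then have w: "\<And>j. w j \<ge> 0" "sum w {..<N} = real N"
      using 3 by (auto simp: w_def)
    have cF: "cmod (F' n) = h n powr (1/p)" for n
      using 3 pq by (simp add: F'_def h_def norm_divide powr_divide powr_powr)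
    have cW: "cmod (W j) = w j powr (1/p)" for j
      by (auto simp: W_def norm_mult norm_sgn w_def)
    have EF: "exp_sum F' {k..l} (real j / real N) = E j / of_real (H powr (1/p))" for j
      by (simp add: E_def exp_sum_def F'_def sum_divide_distrib)
    have WE: "W j * E j = of_real ((real N / Q) powr (1/p) * cmod (E j) powr q)" for j
    proof -
      have "w j powr (1/p) * cmod (E j) = (real N / Q) powr (1/p) * (cmod (E j) powr (q / p) * cmod (E j) powr 1)"
        by (simp only: w_def powr_mult powr_powr) simp
      also have "cmod (E j) powr (q / p) * cmod (E j) powr 1 = cmod (E j) powr q"
        by (simp only: q(2) powr_add[symmetric])
      finally have *: "w j powr (1/p) * cmod (E j) = (real N / Q) powr (1/p) * cmod (E j) powr q" .
      have "cnj (sgn (E j)) * E j = of_real (cmod (E j))"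
        by (cases "E j = 0") (simp_all add: sgn_eq complex_norm_square[symmetric] mult.commute[of "cnj _"] power2_eq_square)
      then show ?thesis
        unfolding *[symmetric] by (simp add: W_def mult_ac)
    qed
    have "(\<Sum>j<N. W j * exp_sum F' {k..l} (real j / real N))
        = of_real ((real N / Q) powr (1/p) * Q / H powr (1/p))"
      by (simp add: EF WE Q_def sum_distrib_left sum_divide_distrib)
    moreover have "cmod (\<Sum>j<N. W j * exp_sum F' {k..l} (real j / real N)) \<le> real N * (1 - \<epsilon>\<^sup>2 / 169) powr \<theta>"
      unfolding \<theta>_def by (rule bilinear_deficit[OF N(2) h(1-3) w \<epsilon> h(4) p1 cF cW])
    ultimately have "\<bar>(real N / Q) powr (1/p) * Q / H powr (1/p)\<bar> \<le> real N * (1 - \<epsilon>\<^sup>2 / 169) powr \<theta>"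
      by (simp only: norm_of_real)
    then have "(real N / Q) powr (1/p) * Q / H powr (1/p) \<le> real N * (1 - \<epsilon>\<^sup>2 / 169) powr \<theta>"
      by linarith
    also have "\<dots> \<le> real N * (1 - \<theta> / 169 * \<epsilon>\<^sup>2)"
      using one_minus_powr_le[of "\<epsilon>\<^sup>2 / 169" \<theta>] \<open>\<epsilon>\<^sup>2 \<le> 1\<close> \<theta> by (intro mult_left_mono) auto
    finally have "(real N / Q) powr (1/p) * (Q / real N) \<le> (1 - \<theta> / 169 * \<epsilon>\<^sup>2) * H powr (1/p)"
      using 3 N by (simp add: field_simps)
    \<comment> \<open>The exponents combine to 1 - 1/p = 1/q, which recovers the norm.\<close>
    moreover have "(real N / Q) powr (1/p) * (Q / real N) = (Q / real N) powr (1/q)"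
    proof -
      have "(real N / Q) powr (1/p) = (Q / real N) powr (- (1/p))"
        using 3 N by (simp add: powr_minus powr_divide)
      then have "(real N / Q) powr (1/p) * (Q / real N) = (Q / real N) powr (- (1/p)) * (Q / real N) powr 1"
        using 3 N by simp
      also have "\<dots> = (Q / real N) powr (- (1/p) + 1)" by (rule powr_add[symmetric])
      also have "- (1/p) + 1 = 1/q" using pq(3) by linarith
      finally show ?thesis .
    qed
    ultimately show ?thesis unfolding gn by (simp add: \<theta>_def H_def)
  qed
qed

text \<open>Truncation does not increase the l^p norm, and \<epsilon> = 0 removes the gain together
  with any condition on the largest coefficient.\<close>

lemma Hausdorff_Young_grid_subset:
  assumes "N > 0" "2 * (l - k) < int N" "S \<subseteq> {k..l}" "1 < p" "p < 2" "1 / p + 1 / q = 1"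
  shows "grid_norm N q (exp_sum F S) \<le> (\<Sum>n\<in>{k..l}. cmod (F n) powr p) powr (1 / p)"
proof -
  define G where "G = (\<lambda>n. if n \<in> S then F n else 0)"
  have nn: "(\<Sum>n\<in>{k..l}. cmod (G n) powr p) \<ge> 0" by (simp add: sum_nonneg)
  have "exp_sum F S = exp_sum G {k..l}"
    unfolding exp_sum_def G_def using assms(3) by (intro ext sum.mono_neutral_cong_left) auto
  then have "grid_norm N q (exp_sum F S) = grid_norm N q (exp_sum G {k..l})" by simp
  also have "grid_norm N q (exp_sum G {k..l})
     \<le> (1 - min (1/p - 1/2) (1 - 1/p) / 169 * 0\<^sup>2) * (\<Sum>n\<in>{k..l}. cmod (G n) powr p) powr (1 / p)"
  proof (rule Hausdorff_Young_grid)
    fix n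
    show "cmod (G n) powr p \<le> (1 - 0) * (\<Sum>n\<in>{k..l}. cmod (G n) powr p)"
    proof (cases "n \<in> S")
      case True
      then show ?thesis using assms(3) member_le_sum[of n "{k..l}" "\<lambda>n. cmod (G n) powr p"] by auto
    qed (use nn in \<open>simp add: G_def\<close>)
  qed (use assms in \<open>auto simp: G_def\<close>)
  also have "\<dots> \<le> (\<Sum>n\<in>{k..l}. cmod (F n) powr p) powr (1 / p)"
    using nn assms(4) by (simp, intro powr_mono2 sum_mono) (auto simp: G_def)
  finally show ?thesis .
qed

section \<open>The nonlinear product\<close>

text \<open>The first row of the product with the scalar \<open>\<Prod>A\<^sub>n\<close> divided out, so that each factor has
  diagonal \<open>1\<close> and off-diagonal entry \<open>F\<^sub>n e\<^bsup>2\<pi>int\<^esup>\<close>.\<close>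

primrec su11_normalized :: "(int \<Rightarrow> complex) \<Rightarrow> real \<Rightarrow> int list \<Rightarrow> complex \<times> complex" where
  "su11_normalized F t [] = (1, 0)"
| "su11_normalized F t (n # ns) =
    (fst (su11_normalized F t ns) + F n * cis (2 * pi * of_int n * t) * cnj (snd (su11_normalized F t ns)),
     snd (su11_normalized F t ns) + F n * cis (2 * pi * of_int n * t) * cnj (fst (su11_normalized F t ns)))"

text \<open>Since B_n = F_n A_n, each factor releases the scalar A_n. The conjugate symmetry of the
  second row is part of the claim because the next step multiplies into that row.\<close>

lemma foldr_su11_factor:
  fixes F :: "int \<Rightarrow> complex" and t :: real
  defines "P \<equiv> \<lambda>ns. foldr (\<lambda>n P. su11_factor F t n ** P) ns (mat 1)"
  shows "P ns $ 1 $ 1 = of_real (prod_list (map (coeff_A F) ns)) * fst (su11_normalized F t ns) \<and>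
    P ns $ 1 $ 2 = of_real (prod_list (map (coeff_A F) ns)) * snd (su11_normalized F t ns) \<and>
    P ns $ 2 $ 1 = cnj (P ns $ 1 $ 2) \<and> P ns $ 2 $ 2 = cnj (P ns $ 1 $ 1)"
proof (induction ns)
  case Nil
  show ?case by (simp add: P_def mat_def)
next
  case (Cons n ns)
  have step: "P (n # ns) = su11_factor F t n ** P ns" by (simp add: P_def)
  have B: "coeff_B F n = F n * of_real (coeff_A F n)" by (simp add: coeff_B_def coeff_A_def)
  show ?case
    unfolding step using Cons.IH
    by (simp add: matrix_matrix_mult_def sum_2 su11_factor_def B cis_cnj algebra_simps)
qed

text \<open>Prepending \<open>n\<close> changes a - 1 by a term of modulus |F_n| |b|, and the
  nonlinear part of b by one of modulus |F_n| |a - 1|. The linear part of b for each tail is a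
  truncated exponential sum, which is why \<open>HY\<close> is assumed for all subsets.\<close>

lemma su11_normalized_estimates:
  assumes N: "N > 0" and q: "q > 1" and H: "H \<ge> 0" and T: "2 * T\<^sup>2 \<le> 1"
    and HY: "\<And>S. S \<subseteq> U \<Longrightarrow> grid_norm N q (exp_sum F S) \<le> H"
    and U: "finite U" "(\<Sum>n\<in>U. cmod (F n)) \<le> T"
    and ns: "distinct ns" "set ns \<subseteq> U"
  shows "grid_norm N q (\<lambda>t. fst (su11_normalized F t ns) - 1) \<le> (\<Sum>n\<in>set ns. cmod (F n)) * (2 * H) \<and>
    grid_norm N q (\<lambda>t. snd (su11_normalized F t ns) - exp_sum F (set ns) t)
      \<le> (\<Sum>n\<in>set ns. cmod (F n)) * (T * (2 * H))"
  using ns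
proof (induction ns)
  case Nil
  show ?case using q by (simp add: grid_norm_def exp_sum_def)
next
  case (Cons n ns)
  let ?a = "\<lambda>t. fst (su11_normalized F t ns)" and ?b = "\<lambda>t. snd (su11_normalized F t ns)"
  let ?e = "\<lambda>t. cis (2 * pi * of_int n * t)"
  let ?s = "\<Sum>n\<in>set ns. cmod (F n)"
  have T0: "T \<ge> 0" using U(2) by (meson norm_ge_zero order_trans sum_nonneg)
  have s: "?s \<le> T" "?s \<ge> 0"
    using Cons.prems(2) U sum_mono2[of U "set ns" "\<lambda>n. cmod (F n)"] by (auto intro: sum_nonneg)
  have IH: "grid_norm N q (\<lambda>t. ?a t - 1) \<le> ?s * (2 * H)"
    "grid_norm N q (\<lambda>t. ?b t - exp_sum F (set ns) t) \<le> ?s * (T * (2 * H))"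
    using Cons by auto
  \<comment> \<open>The remainder of b is at most 2T^2 H <= H and its linear part at most H, so the
    bound 2H reproduces itself along the induction.\<close>
  have "grid_norm N q ?b \<le> grid_norm N q (\<lambda>t. ?b t - exp_sum F (set ns) t) + grid_norm N q (exp_sum F (set ns))"
    using grid_norm_triangle[of N q "\<lambda>t. ?b t - exp_sum F (set ns) t" "exp_sum F (set ns)"] N q by simp
  also have "\<dots> \<le> ?s * (T * (2 * H)) + H"
    using Cons.prems(2) by (intro add_mono IH HY) auto
  also have "?s * (T * (2 * H)) \<le> T * (T * (2 * H))"
    using s T0 H by (intro mult_right_mono) auto
  also have "\<dots> = (2 * T\<^sup>2) * H" by (simp add: power2_eq_square)
  also have "\<dots> \<le> 1 * H" using T H by (intro mult_right_mono) auto
  finally have b: "grid_norm N q ?b \<le> 2 * H" by simp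
  have "grid_norm N q (\<lambda>t. (?a t - 1) + F n * ?e t * cnj (?b t))
     \<le> grid_norm N q (\<lambda>t. ?a t - 1) + grid_norm N q (\<lambda>t. F n * ?e t * cnj (?b t))"
    using N q by (intro grid_norm_triangle) auto
  also have "grid_norm N q (\<lambda>t. F n * ?e t * cnj (?b t)) = cmod (F n) * grid_norm N q ?b"
    using q by (intro grid_norm_scale) (auto simp: norm_mult)
  also have "grid_norm N q (\<lambda>t. ?a t - 1) + cmod (F n) * grid_norm N q ?b \<le> ?s * (2 * H) + cmod (F n) * (2 * H)"
    using b by (intro add_mono IH mult_left_mono) auto
  finally have 1: "grid_norm N q (\<lambda>t. (?a t - 1) + F n * ?e t * cnj (?b t)) \<le> (cmod (F n) + ?s) * (2 * H)"
    by (simp add: algebra_simps)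
  have "grid_norm N q (\<lambda>t. (?b t - exp_sum F (set ns) t) + F n * ?e t * cnj (?a t - 1))
     \<le> grid_norm N q (\<lambda>t. ?b t - exp_sum F (set ns) t) + grid_norm N q (\<lambda>t. F n * ?e t * cnj (?a t - 1))"
    using N q by (intro grid_norm_triangle) auto
  also have "grid_norm N q (\<lambda>t. F n * ?e t * cnj (?a t - 1)) = cmod (F n) * grid_norm N q (\<lambda>t. ?a t - 1)"
    using q by (intro grid_norm_scale) (auto simp: norm_mult simp del: complex_cnj_diff)
  also have "grid_norm N q (\<lambda>t. ?b t - exp_sum F (set ns) t) + cmod (F n) * grid_norm N q (\<lambda>t. ?a t - 1)
     \<le> ?s * (T * (2 * H)) + cmod (F n) * (T * (2 * H))"
  proof (intro add_mono IH mult_left_mono)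
    show "grid_norm N q (\<lambda>t. ?a t - 1) \<le> T * (2 * H)"
      using IH(1) mult_right_mono[OF s(1), of "2 * H"] H by linarith
  qed auto
  finally have 2: "grid_norm N q (\<lambda>t. (?b t - exp_sum F (set ns) t) + F n * ?e t * cnj (?a t - 1))
     \<le> (cmod (F n) + ?s) * (T * (2 * H))"
    by (simp add: algebra_simps)
  have "(\<lambda>t. fst (su11_normalized F t (n # ns)) - 1) = (\<lambda>t. (?a t - 1) + F n * ?e t * cnj (?b t))"
    by auto
  moreover have "(\<lambda>t. snd (su11_normalized F t (n # ns)) - exp_sum F (set (n # ns)) t)
     = (\<lambda>t. (?b t - exp_sum F (set ns) t) + F n * ?e t * cnj (?a t - 1))"
    using Cons.prems(1) by (auto simp: exp_sum_def algebra_simps)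
  moreover have "(\<Sum>n\<in>set (n # ns). cmod (F n)) = cmod (F n) + ?s"
    using Cons.prems(1) by simp
  ultimately show ?case using 1 2 by (simp only:)
qed

section \<open>The scalar factor and the balance of errors against the gain\<close>

text \<open>The Weierstrass product inequality; the upper bound 1 is carried along for the
  induction.\<close>

lemma one_minus_sum_le_prod:
  fixes y :: "'i \<Rightarrow> real"
  assumes "finite U" "\<And>i. i \<in> U \<Longrightarrow> 0 \<le> y i \<and> y i \<le> 1"
  shows "1 - sum y U \<le> (\<Prod>i\<in>U. 1 - y i) \<and> (\<Prod>i\<in>U. 1 - y i) \<le> 1"
  using assms
proof (induction U rule: finite_induct)
  case (insert i U)
  have "(\<Prod>i\<in>U. 1 - y i) * (1 - y i) \<ge> (\<Prod>i\<in>U. 1 - y i) - y i"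
    using insert mult_right_mono[of "\<Prod>i\<in>U. 1 - y i" 1 "y i"] by (auto simp: algebra_simps)
  moreover have "(\<Prod>i\<in>U. 1 - y i) \<ge> 0" using insert by (intro prod_nonneg) auto
  ultimately show ?case using insert mult_mono[of "1 - y i" 1 "\<Prod>i\<in>U. 1 - y i" 1] by (auto simp: mult.commute)
qed simp

text \<open>The square of the product is the reciprocal of a Weierstrass product, which is at least
  1 - T^2.\<close>

lemma prod_coeff_A_le:
  assumes F: "\<And>n. cmod (F n) < 1" and U: "finite U" "(\<Sum>n\<in>U. cmod (F n)) \<le> T" and T: "2 * T\<^sup>2 \<le> 1"
  shows "(\<Prod>n\<in>U. coeff_A F n) \<le> 1 + T\<^sup>2"
proof -
  have pos: "1 - (cmod (F n))\<^sup>2 > 0" for n using F[of n] by (simp add: power_less_one_iff)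
  have "(\<Sum>n\<in>U. (cmod (F n))\<^sup>2) \<le> (\<Sum>n\<in>U. cmod (F n) * (\<Sum>n\<in>U. cmod (F n)))"
    using U(1) by (auto intro!: sum_mono mult_left_mono member_le_sum simp: power2_eq_square)
  also have "\<dots> = (\<Sum>n\<in>U. cmod (F n))\<^sup>2" by (simp add: power2_eq_square sum_distrib_right)
  also have "\<dots> \<le> T\<^sup>2" using U(2) by (intro power_mono) (auto intro: sum_nonneg)
  finally have "1 - T\<^sup>2 \<le> (\<Prod>n\<in>U. 1 - (cmod (F n))\<^sup>2)"
    using one_minus_sum_le_prod[of U "\<lambda>n. (cmod (F n))\<^sup>2"] U(1) pos less_imp_le[OF pos] by force
  moreover have "(\<Prod>n\<in>U. coeff_A F n)\<^sup>2 * (\<Prod>n\<in>U. 1 - (cmod (F n))\<^sup>2) = 1"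
  proof -
    have "(coeff_A F n)\<^sup>2 * (1 - (cmod (F n))\<^sup>2) = 1" for n
      using pos[of n] by (simp add: coeff_A_def power_divide)
    then show ?thesis by (simp only: prod_power_distrib prod.distrib[symmetric]) simp
  qed
  ultimately have "(\<Prod>n\<in>U. coeff_A F n)\<^sup>2 * (1 - T\<^sup>2) \<le> 1"
    by (metis mult_left_mono zero_le_power2)
  also have "1 \<le> (1 + T\<^sup>2)\<^sup>2 * (1 - T\<^sup>2)"
  proof -
    \<comment> \<open>The difference of the two sides is y(1 - y - y^2).\<close>
    have "1 \<le> (1 + y)\<^sup>2 * (1 - y)" if "0 \<le> y" "2 * y \<le> 1" for y :: real
    proof -
      have "y * y \<le> 1/2 * y" using that by (intro mult_right_mono) auto
      then have "0 \<le> y * (1 - y - y * y)" using that by (intro mult_nonneg_nonneg) linarith+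
      then show ?thesis by (simp add: power2_eq_square algebra_simps)
    qed
    then show ?thesis using T by simp
  qed
  finally have "(\<Prod>n\<in>U. coeff_A F n)\<^sup>2 \<le> (1 + T\<^sup>2)\<^sup>2"
    using T by (simp add: mult_le_cancel_right)
  then show ?thesis by (rule power2_le_imp_le) simp
qed

text \<open>The linear part has norm at most (1 - c \<epsilon>^2) H and the remainder at most 2T^2
  H. As c \<epsilon>^2 >= 4T^2, together they give (1 - 2T^2) H, which still absorbs the scalar
  factor 1 + T^2.\<close>

lemma grid_norm_su11_b_le:
  fixes F :: "int \<Rightarrow> complex"
  defines "c \<equiv> \<lambda>p. min (1/p - 1/2) (1 - 1/p) / 169"
  assumes N: "N > 0" "2 * (l - k) < int N" and F1: "\<And>n. cmod (F n) < 1" and F0: "\<And>n. n \<notin> {k..l} \<Longrightarrow> F n = 0"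
    and pq: "1 < p" "p < 2" "1 / p + 1 / q = 1" and \<epsilon>: "0 \<le> \<epsilon>" "\<epsilon> \<le> 1"
    and max: "\<And>n. cmod (F n) powr p \<le> (1 - \<epsilon>) * (\<Sum>n\<in>{k..l}. cmod (F n) powr p)"
    and T: "(\<Sum>n\<in>{k..l}. cmod (F n)) \<le> T" "2 * T\<^sup>2 \<le> 1" "4 * T\<^sup>2 \<le> c p * \<epsilon>\<^sup>2"
  shows "grid_norm N q (\<lambda>t. su11_product F t $ 1 $ 2) \<le> (\<Sum>n\<in>{k..l}. cmod (F n) powr p) powr (1 / p)"
proof -
  define H where "H = (\<Sum>n\<in>{k..l}. cmod (F n) powr p) powr (1 / p)"
  let ?b = "\<lambda>t. snd (su11_normalized F t [k..l])"
  define A where "A = (\<Prod>n\<in>{k..l}. coeff_A F n)"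
  have H0: "H \<ge> 0" by (simp add: H_def)
  have q: "q > 1"
  proof -
    have "1 / p > 0" "1 / p < 1" using pq(1) by simp_all
    then have "1 / q > 0" "1 / q < 1" using pq(3) by linarith+
    then show ?thesis by (simp add: field_simps)
  qed
  have T0: "T \<ge> 0" using T(1) by (meson norm_ge_zero order_trans sum_nonneg)
  have "grid_norm N q (\<lambda>t. ?b t - exp_sum F {k..l} t) \<le> (\<Sum>n\<in>{k..l}. cmod (F n)) * (T * (2 * H))"
    using su11_normalized_estimates[OF N(1) q H0 T(2) _ _ T(1), where ns = "[k..l]"]
      Hausdorff_Young_grid_subset[OF N _ pq] by (simp add: H_def)
  also have "\<dots> \<le> T * (T * (2 * H))" using T(1) T0 H0 by (intro mult_right_mono) auto
  finally have "grid_norm N q (\<lambda>t. ?b t - exp_sum F {k..l} t) \<le> 2 * T\<^sup>2 * H" by (simp add: power2_eq_square)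
  moreover have "grid_norm N q (exp_sum F {k..l}) \<le> (1 - c p * \<epsilon>\<^sup>2) * H"
    unfolding H_def c_def by (rule Hausdorff_Young_grid[OF N F0 pq \<epsilon> max])
  ultimately have b: "grid_norm N q ?b \<le> (1 - c p * \<epsilon>\<^sup>2) * H + 2 * T\<^sup>2 * H"
    using grid_norm_triangle[of N q "\<lambda>t. ?b t - exp_sum F {k..l} t" "exp_sum F {k..l}"] N q by simp
  also have "\<dots> \<le> (1 - 2 * T\<^sup>2) * H"
    using mult_right_mono[OF T(3) H0] by (simp add: algebra_simps)
  finally have b: "grid_norm N q ?b \<le> (1 - 2 * T\<^sup>2) * H" .
  have A: "A \<ge> 0" "A \<le> 1 + T\<^sup>2"
  proof -
    have "(cmod (F n))\<^sup>2 \<le> 1" for n using F1[of n] by (simp add: power_le_one less_imp_le)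
    then show "A \<ge> 0" unfolding A_def coeff_A_def by (intro prod_nonneg) auto
    show "A \<le> 1 + T\<^sup>2" unfolding A_def by (rule prod_coeff_A_le[OF F1 _ T(1,2)]) simp
  qed
  have "su11_product F t $ 1 $ 2 = of_real A * ?b t" for t
  proof -
    have "{n. F n \<noteq> 0} \<subseteq> {k..l}" using F0 by blast
    then have "su11_product F t $ 1 $ 2 = of_real (prod_list (map (coeff_A F) [k..l])) * ?b t"
      using foldr_su11_factor[of F t "[k..l]"] by (simp add: su11_product_eq_interval)
    also have "prod_list (map (coeff_A F) [k..l]) = A"
      unfolding A_def by (subst prod.distinct_set_conv_list[symmetric]) auto
    finally show ?thesis .
  qed
  then have "grid_norm N q (\<lambda>t. su11_product F t $ 1 $ 2) = A * grid_norm N q ?b"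
    using q A by (intro grid_norm_scale) (auto simp: norm_mult)
  also have "\<dots> \<le> (1 + T\<^sup>2) * ((1 - 2 * T\<^sup>2) * H)"
    using A b by (intro mult_mono grid_norm_nonneg) auto
  also have "\<dots> \<le> 1 * H"
    unfolding mult.assoc[symmetric] using H0
    by (intro mult_right_mono) (auto simp: algebra_simps)
  finally show ?thesis by (simp add: H_def)
qed

section \<open>From the grid to the circle\<close>

text \<open>By uniform continuity the integrand on each cell exceeds its value at the left endpoint
  by at most e once the mesh is below d; the cells are added by induction.\<close>

lemma integral_le_Riemann_bound:
  fixes g :: "real \<Rightarrow> real"
  assumes g: "continuous_on {0..1} g"
    and C: "\<And>N. N \<ge> N0 \<Longrightarrow> (\<Sum>j<N. g (real j / real N)) / real N \<le> C"
  shows "integral {0..1} g \<le> C"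
proof (rule field_le_epsilon)
  fix e :: real assume "e > 0"
  obtain d where d: "d > 0" "\<And>x y. x \<in> {0..1} \<Longrightarrow> y \<in> {0..1} \<Longrightarrow> dist y x < d \<Longrightarrow> dist (g y) (g x) < e"
    using compact_uniformly_continuous[OF g] \<open>e > 0\<close> unfolding uniformly_continuous_on_def
    by (metis compact_Icc)
  obtain N1 where N1: "1 / d < real N1" using reals_Archimedean2 by blast
  define N where "N = max (Suc N0) N1"
  have N: "N > 0" "N \<ge> N0" "1 / d < real N" using N1 by (auto simp: N_def)
  then have Nd: "1 / real N < d" using d(1) by (simp add: field_simps)
  have "integral {0..real m / real N} g \<le> (\<Sum>j<m. (g (real j / real N) + e) / real N)" if "m \<le> N" for m
    using that
  proof (induction m)
    case (Suc m)
    let ?a = "real m / real N" and ?b = "real (Suc m) / real N"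
    have ab: "0 \<le> ?a" "?a \<le> ?b" "?b \<le> 1" "?b - ?a = 1 / real N"
      using Suc.prems N(1) by (auto simp: field_simps)
    have int: "g integrable_on {x..y}" if "0 \<le> x" "y \<le> 1" for x y
      using that by (intro integrable_continuous_real continuous_on_subset[OF g]) auto
    have "integral {?a..?b} g \<le> integral {?a..?b} (\<lambda>_. g ?a + e)"
    proof (rule integral_le)
      fix x assume x: "x \<in> {?a..?b}"
      then have "x \<in> {0..1}" "?a \<in> {0..1}" using ab(1-3) unfolding atLeastAtMost_iff by linarith+
      moreover have "dist x ?a < d" using x ab(4) Nd unfolding dist_real_def atLeastAtMost_iff by linarith
      ultimately have "dist (g x) (g ?a) < e" using d(2) by blast
      then show "g x \<le> g ?a + e" by (simp add: dist_real_def)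
    qed (use int ab in auto)
    also have "\<dots> = (g ?a + e) / real N"
      using ab by (simp add: divide_simps)
    finally have "integral {?a..?b} g \<le> (g ?a + e) / real N" .
    moreover have "integral {0..?b} g = integral {0..?a} g + integral {?a..?b} g"
      using ab int by (intro Henstock_Kurzweil_Integration.integral_combine[symmetric]) auto
    ultimately show ?case using Suc by simp
  qed simp
  from this[of N] have "integral {0..1} g \<le> (\<Sum>j<N. (g (real j / real N) + e) / real N)"
    using N(1) by simp
  also have "\<dots> = (\<Sum>j<N. g (real j / real N)) / real N + e"
    using N(1) by (simp add: sum.distrib add_divide_distrib sum_divide_distrib)
  finally show "integral {0..1} g \<le> C + e" using C[OF N(2)] by linarith
qed

section \<open>The norms of the statement and the logarithms\<close>

lemma lp_norm_finite_support:
  assumes "finite U" "\<And>n. n \<notin> U \<Longrightarrow> f n = 0"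
  shows "lp_norm p f = (\<Sum>n\<in>U. norm (f n) powr p) powr (1 / p)"
proof -
  have "(\<Sum>\<^sub>\<infinity>n. norm (f n) powr p) = (\<Sum>\<^sub>\<infinity>n\<in>U. norm (f n) powr p)"
    using assms(2) by (intro infsum_cong_neutral) auto
  then show ?thesis using assms(1) by (simp add: lp_norm_def)
qed

text \<open>Finite support makes the range finite, hence bounded, so the real supremum is a genuine
  upper bound.\<close>

lemma linf_norm_upper:
  assumes "finite {n. F n \<noteq> 0}"
  shows "norm (F n) \<le> linf_norm F"
proof -
  have "range (\<lambda>n. norm (F n)) \<subseteq> insert 0 ((\<lambda>n. norm (F n)) ` {n. F n \<noteq> 0})" by auto
  then have "finite (range (\<lambda>n. norm (F n)))" using assms finite_subset by blast
  then show ?thesis unfolding linf_norm_def by (intro cSUP_upper bdd_above_finite) auto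
qed

lemma ln_norm_su11_a_le:
  assumes "\<And>n. cmod (F n) < 1" "finite {n. F n \<noteq> 0}"
  shows "ln ((cmod (su11_a F t))\<^sup>2) \<le> (cmod (su11_product F t $ 1 $ 2))\<^sup>2"
    and "ln ((cmod (su11_a F t))\<^sup>2) \<ge> 0"
proof -
  have *: "(cmod (su11_a F t))\<^sup>2 = 1 + (cmod (su11_product F t $ 1 $ 2))\<^sup>2"
    using is_su11_product[OF assms, of t] by (simp add: is_su11_def su11_a_def)
  show "ln ((cmod (su11_a F t))\<^sup>2) \<le> (cmod (su11_product F t $ 1 $ 2))\<^sup>2"
    unfolding * by (rule ln_add_one_self_le_self) simp
  show "ln ((cmod (su11_a F t))\<^sup>2) \<ge> 0" unfolding * by (rule ln_ge_zero) simp
qed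

lemma norm_le_sqrt_ln_coeff_A:
  assumes "cmod (F n) < 1"
  shows "cmod (F n) \<le> sqrt (ln (\<bar>coeff_A F n\<bar>\<^sup>2))"
proof -
  have pos: "1 - (cmod (F n))\<^sup>2 > 0" using assms by (simp add: power_less_one_iff)
  have "ln (1 - (cmod (F n))\<^sup>2) \<le> - (cmod (F n))\<^sup>2" using ln_le_minus_one[OF pos] by simp
  moreover have "\<bar>coeff_A F n\<bar>\<^sup>2 = inverse (1 - (cmod (F n))\<^sup>2)"
    using pos by (simp add: coeff_A_def power_divide inverse_eq_divide)
  ultimately have "(cmod (F n))\<^sup>2 \<le> ln (\<bar>coeff_A F n\<bar>\<^sup>2)"
    using pos by (simp add: ln_inverse)
  then show ?thesis by (rule real_le_rsqrt)
qed

text \<open>The logarithm is compared with |b| at the sample points, so only the continuous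
  integrand built from a has to pass to the limit.\<close>

lemma Lq_norm_su11_a_le:
  assumes F: "\<And>n. cmod (F n) < 1" "finite {n. F n \<noteq> 0}" and q: "q > 0" and H: "H \<ge> 0"
    and b: "\<And>N. N \<ge> N0 \<Longrightarrow> grid_norm N q (\<lambda>t. su11_product F t $ 1 $ 2) \<le> H"
  shows "Lq_norm_torus q (\<lambda>t. sqrt (ln ((cmod (su11_a F t))\<^sup>2))) \<le> H"
proof -
  define g where "g = (\<lambda>t. \<bar>sqrt (ln ((cmod (su11_a F t))\<^sup>2))\<bar> powr q)"
  have nz: "su11_a F t \<noteq> 0" for t
    using cmod_su11_a_ge_1[OF F, of t] by auto
  have cont: "continuous_on {0..1} g"
    unfolding g_def using continuous_on_subset[OF continuous_on_su11_product[OF F(2), of 1 1]] q nz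
    by (intro continuous_on_powr' continuous_intros) (auto simp: su11_a_def)
  have le: "g t \<le> cmod (su11_product F t $ 1 $ 2) powr q" for t
    unfolding g_def using ln_norm_su11_a_le[OF F, of t] q by (intro powr_mono2) (auto intro: real_le_lsqrt)
  have "integral {0..1} g \<le> H powr q"
  \<comment> \<open>The successor guarantees N > 0.\<close>
  proof (rule integral_le_Riemann_bound[OF cont, of "Suc N0"])
    fix N assume "N \<ge> Suc N0"
    then have "N > 0" "grid_norm N q (\<lambda>t. su11_product F t $ 1 $ 2) \<le> H" using b[of N] by simp_all
    then have "(\<Sum>j<N. cmod (su11_product F (real j / real N) $ 1 $ 2) powr q) / real N \<le> H powr q"
      using grid_norm_le_iff[OF _ q H] by simp
    moreover have "(\<Sum>j<N. g (real j / real N)) / real N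
        \<le> (\<Sum>j<N. cmod (su11_product F (real j / real N) $ 1 $ 2) powr q) / real N"
      by (intro divide_right_mono sum_mono le) auto
    ultimately show "(\<Sum>j<N. g (real j / real N)) / real N \<le> H powr q" by linarith
  qed
  moreover have "integral {0..1} g = (LINT t:{0..<1}|lborel. g t)"
    using interval_integral_eq_integral[of 0 1 g] interval_integral_Ico[of 0 1 g]
      borel_integrable_atLeastAtMost'[OF cont] by simp
  ultimately have int: "(LINT t:{0..<1}|lborel. g t) \<le> H powr q" by simp
  have "integral {0..1} g \<ge> 0"
    using cont by (intro integral_nonneg integrable_continuous_real) (auto simp: g_def)
  then have "(LINT t:{0..<1}|lborel. g t) powr (1 / q) \<le> (H powr q) powr (1 / q)"
    using int \<open>integral {0..1} g = _\<close> q by (intro powr_mono2) auto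
  then show ?thesis using q H by (simp add: Lq_norm_torus_def powr_powr g_def)
qed

theorem theorem2:
  fixes p q :: real
  assumes "1 < p" and "p < 2" and "2 < q" and "1 / p + 1 / q = 1"
  shows "\<exists>\<alpha> \<delta> :: real. \<alpha> > 0 \<and> \<delta> > 0 \<and>
    (\<forall>F :: int \<Rightarrow> complex.
       (\<forall>n. cmod (F n) < 1) \<longrightarrow>
       finite {n. F n \<noteq> 0} \<longrightarrow>
       (\<exists>n. F n \<noteq> 0) \<longrightarrow>
       lp_norm 1 F \<le> \<delta> * (1 - linf_norm F / lp_norm p F) powr \<alpha> \<longrightarrow>
       Lq_norm_torus q (\<lambda>t. sqrt (ln ((cmod (su11_a F t))\<^sup>2)))
         \<le> lp_norm p (\<lambda>n. sqrt (ln (\<bar>coeff_A F n\<bar>\<^sup>2))))"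
proof -
  define c where "c = min (1/p - 1/2) (1 - 1/p) / 169"
  have p1: "1/2 < 1 / p" "1 / p < 1" using assms by (simp_all add: field_simps)
  have c: "c > 0" "c \<le> 1" using p1 by (auto simp: c_def)
  \<comment> \<open>Chosen so that squaring the smallness hypothesis gives exactly 4T^2 <= c
    \<epsilon>^2.\<close>
  define \<delta> where "\<delta> = sqrt c / 2"
  have \<delta>: "\<delta> > 0" "4 * \<delta>\<^sup>2 = c" using c by (auto simp: \<delta>_def power_divide)
  have main: "Lq_norm_torus q (\<lambda>t. sqrt (ln ((cmod (su11_a F t))\<^sup>2)))
         \<le> lp_norm p (\<lambda>n. sqrt (ln (\<bar>coeff_A F n\<bar>\<^sup>2)))"
    if F: "\<And>n. cmod (F n) < 1" and fin: "finite {n. F n \<noteq> 0}" and nz: "F m \<noteq> 0"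
      and small: "lp_norm 1 F \<le> \<delta> * (1 - linf_norm F / lp_norm p F) powr 1"
    for F :: "int \<Rightarrow> complex" and m
  proof -
    obtain k l where kl: "{n. F n \<noteq> 0} \<subseteq> {k..l}"
      using finite_subset_int_interval[OF fin] by blast
    then have F0: "F n = 0" if "n \<notin> {k..l}" for n using that by blast
    define S where "S = (\<Sum>n\<in>{k..l}. cmod (F n) powr p)"
    define H where "H = S powr (1 / p)"
    have lpF: "lp_norm p F = H" "lp_norm 1 F = (\<Sum>n\<in>{k..l}. cmod (F n))"
      using lp_norm_finite_support[of "{k..l}" F] F0 by (auto simp: H_def S_def sum_nonneg)
    have le_S: "cmod (F n) powr p \<le> S" for n
      using member_le_sum[of n "{k..l}" "\<lambda>n. cmod (F n) powr p"] F0[of n]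
      by (cases "n \<in> {k..l}") (auto simp: S_def sum_nonneg)
    have S: "S > 0" using le_S[of m] nz by (smt (verit) powr_gt_zero zero_less_norm_iff)
    then have H: "H > 0" "H powr p = S" using assms(1) by (auto simp: H_def powr_powr)
    define x where "x = linf_norm F / lp_norm p F"
    have linf: "cmod (F n) \<le> linf_norm F" for n by (rule linf_norm_upper[OF fin])
    have "linf_norm F \<le> H"
      unfolding linf_norm_def
    proof (rule cSUP_least)
      fix n
      have "(cmod (F n) powr p) powr (1 / p) \<le> S powr (1 / p)"
        using le_S assms(1) by (intro powr_mono2) auto
      then show "cmod (F n) \<le> H" using assms(1) by (simp add: H_def powr_powr)
    qed simp
    then have x: "0 \<le> x" "x \<le> 1"
      using H linf[of m] norm_ge_zero[of "F m"] by (auto simp: x_def lpF simp del: norm_ge_zero)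
    \<comment> \<open>In terms of |F|^p the largest share of mass is at most x^p <= x, so \<epsilon>
      = 1 - x is admissible.\<close>
    have max: "cmod (F n) powr p \<le> (1 - (1 - x)) * S" for n
    proof -
      have "cmod (F n) \<le> x * H" using linf[of n] H by (simp add: x_def lpF)
      then have "cmod (F n) powr p \<le> (x * H) powr p" using assms(1) by (intro powr_mono2) auto
      also have "\<dots> = x powr p * S" by (simp add: powr_mult H)
      also have "\<dots> \<le> x powr 1 * S"
        using x assms(1) S by (intro mult_right_mono powr_mono') auto
      finally show ?thesis using x by simp
    qed
    let ?T = "\<Sum>n\<in>{k..l}. cmod (F n)"
    have "?T \<le> \<delta> * (1 - x)" using small x by (simp add: lpF x_def)
    then have "?T\<^sup>2 \<le> (\<delta> * (1 - x))\<^sup>2" by (intro power_mono) (auto intro: sum_nonneg)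
    then have T: "4 * ?T\<^sup>2 \<le> c * (1 - x)\<^sup>2"
      unfolding \<delta>(2)[symmetric] power_mult_distrib by linarith
    have "c * (1 - x)\<^sup>2 \<le> 1 * 1" using c x by (intro mult_mono) (auto simp: power_le_one)
    with T have T2: "2 * ?T\<^sup>2 \<le> 1" by simp
    have ptw: "cmod (F n) \<le> norm (sqrt (ln (\<bar>coeff_A F n\<bar>\<^sup>2)))" for n
      using norm_le_sqrt_ln_coeff_A[of F n] F[of n] by simp
    have "Lq_norm_torus q (\<lambda>t. sqrt (ln ((cmod (su11_a F t))\<^sup>2))) \<le> H"
    proof (rule Lq_norm_su11_a_le[OF F fin])
      \<comment> \<open>From this threshold on, sampling also separates the frequencies of the
        squared exponential sum.\<close>
      fix N assume "N \<ge> Suc (nat (2 * (l - k)))"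
      then have N: "N > 0" "2 * (l - k) < int N" by linarith+
      show "grid_norm N q (\<lambda>t. su11_product F t $ 1 $ 2) \<le> H"
        unfolding H_def S_def
        by (rule grid_norm_su11_b_le[OF N F F0 assms(1,2,4) _ _ max[unfolded S_def] order_refl T2 T[unfolded c_def]])
          (use x in auto)
    qed (use assms H in auto)
    also have "H \<le> (\<Sum>n\<in>{k..l}. norm (sqrt (ln (\<bar>coeff_A F n\<bar>\<^sup>2))) powr p) powr (1 / p)"
      unfolding H_def S_def using assms(1) ptw
      by (intro powr_mono2 sum_mono sum_nonneg) simp_all
    also have "\<dots> = lp_norm p (\<lambda>n. sqrt (ln (\<bar>coeff_A F n\<bar>\<^sup>2)))"
      using F0 by (intro lp_norm_finite_support[symmetric]) (auto simp: coeff_A_def)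
    finally show ?thesis .
  qed
  show ?thesis
    \<comment> \<open>The gain is quadratic in \<epsilon> and the error quadratic in the l^1 norm,
      so a linear relation between the two suffices.\<close>
    by (rule exI[of _ 1], rule exI[of _ \<delta>]) (use \<delta> main in auto)
qed

end
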